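(* Let $b_1,b_2$ be real constants, let $(\dot B^1(t;b_1))_{0\le t\le1}$ and $(\dot B^2(t;b_2))_{0\le t\le1}$ be two independent standard Brownian bridges terminating at $b_1$ and $b_2$, respectively, and let $$M_{bb}:=\begin{pmatrix} b_1 & Y_1+iZ_1 \\ Y_1-iZ_1 & b_2 \end{pmatrix},$$ where $Y_1$ and $Z_1$ are independent centered normal random variables with variance $1/2$. Then the largest eigenvalue of $M_{bb}$ has the same law as $$V_{bb}:=\max_{0\le t\le1}\left((\dot B^1(t;b_1)-\dot B^1(0;b_1))+(\dot B^2(1;b_2)-\dot B^2(t;b_2))\right).$$
   Context: A standard Brownian bridge terminating at $b$ is a process $(\dot B(t;b))_{0\le t\le1}$ equal in law to $(B(t)-tB(1)+bt)_{0\le t\le1}$, where $B$ is a standard Brownian motion. *)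

theory Defs
  imports "HOL-Probability.Probability" "Jordan_Normal_Form.Char_Poly"
begin

definition equal_in_law ::
  "'c measure \<Rightarrow> 'a measure \<Rightarrow> ('a \<Rightarrow> 'c) \<Rightarrow> 'b measure \<Rightarrow> ('b \<Rightarrow> 'c) \<Rightarrow> bool" where
  "equal_in_law S M X N Y \<longleftrightarrow> X \<in> measurable M S \<and> Y \<in> measurable N S \<and> distr M S X = distr N S Y"

text \<open>The second argument of \<^const>\<open>normal_density\<close> is the standard deviation, not the variance.\<close>

definition standard_brownian_motion :: "'a measure \<Rightarrow> (real \<Rightarrow> 'a \<Rightarrow> real) \<Rightarrow> bool" where
  "standard_brownian_motion M B \<longleftrightarrow>
     prob_space M \<and>
     (\<forall>t\<ge>0. B t \<in> borel_measurable M) \<and>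
     (AE \<omega> in M. B 0 \<omega> = 0) \<and>
     (\<forall>s t. 0 \<le> s \<and> s < t \<longrightarrow>
        distributed M lborel (\<lambda>\<omega>. B t \<omega> - B s \<omega>) (normal_density 0 (sqrt (t - s)))) \<and>
     (\<forall>(n::nat) (\<tau> :: nat \<Rightarrow> real). 0 \<le> \<tau> 0 \<and> (\<forall>i<n. \<tau> i < \<tau> (Suc i)) \<longrightarrow>
        prob_space.indep_vars M (\<lambda>_. borel) (\<lambda>i \<omega>. B (\<tau> (Suc i)) \<omega> - B (\<tau> i) \<omega>) {..<n}) \<and>
     (\<forall>\<omega>\<in>space M. continuous_on {0..} (\<lambda>t. B t \<omega>))"

text \<open>The trajectory on $[0,1]$ as a random element of the product space over $[0,1]$. For
  processes with continuous paths, its law determines the law on $C[0,1]$.\<close>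

definition path01 :: "(real \<Rightarrow> 'a \<Rightarrow> real) \<Rightarrow> 'a \<Rightarrow> real \<Rightarrow> real" where
  "path01 X \<omega> = (\<lambda>t\<in>{0..1}. X t \<omega>)"

abbreviation path_space01 :: "(real \<Rightarrow> real) measure" where
  "path_space01 \<equiv> PiM {0..1} (\<lambda>_. borel)"

text \<open>The Brownian motion may live on a probability space other than \<open>M\<close>. Since types cannot be
  quantified, that space is taken to consist of functions from reals to reals. This is no
  restriction: the law of any standard Brownian motion is carried by such a space, namely the
  continuous functions with the coordinate process.\<close>

definition standard_brownian_bridge :: "'a measure \<Rightarrow> real \<Rightarrow> (real \<Rightarrow> 'a \<Rightarrow> real) \<Rightarrow> bool" where
  "standard_brownian_bridge M b X \<longleftrightarrow>
     prob_space M \<and>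
     (\<forall>\<omega>\<in>space M. continuous_on {0..1} (\<lambda>t. X t \<omega>)) \<and>
     (\<exists>(N :: (real \<Rightarrow> real) measure) B. standard_brownian_motion N B \<and>
        equal_in_law path_space01 M (path01 X) N (path01 (\<lambda>t \<omega>. B t \<omega> - t * B 1 \<omega> + b * t)))"

definition M_bb :: "real \<Rightarrow> real \<Rightarrow> real \<Rightarrow> real \<Rightarrow> complex mat" where
  "M_bb b1 b2 y z = mat_of_rows_list 2
     [[complex_of_real b1, complex_of_real y + \<i> * complex_of_real z],
      [complex_of_real y - \<i> * complex_of_real z, complex_of_real b2]]"

text \<open>Meant for Hermitian matrices, all of whose eigenvalues are real.\<close>

definition largest_eigenvalue :: "complex mat \<Rightarrow> real" where
  "largest_eigenvalue A = Max {x :: real. eigenvalue A (complex_of_real x)}"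

text \<open>The supremum is over the compact interval $[0,1]$ and hence attained when the paths are
  continuous; \<^const>\<open>Max\<close> is only meaningful for finite sets.\<close>

definition V_bb :: "(real \<Rightarrow> 'a \<Rightarrow> real) \<Rightarrow> (real \<Rightarrow> 'a \<Rightarrow> real) \<Rightarrow> 'a \<Rightarrow> real" where
  "V_bb X1 X2 \<omega> = (SUP t\<in>{0..1}. (X1 t \<omega> - X1 0 \<omega>) + (X2 1 \<omega> - X2 t \<omega>))"

end

theory Submission imports Defs begin

text \<open>Both distribution functions equal \<open>1 - exp (- (x - b1) (x - b2))\<close> for \<open>x \<ge> max b1 b2\<close>. For the
  eigenvalue this is the exponential law of \<open>Y\<^sup>2 + Z\<^sup>2\<close>. The maximum is that of a Brownian bridge of
  variance \<open>2\<close>. Given its values on a grid of mesh \<open>1 / n\<close>, the probability of staying below \<open>x\<close>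
  is a product of factors \<open>1 - exp (- n u w)\<close>, where \<open>u\<close> and \<open>w\<close> are the distances to \<open>x\<close> at
  neighbouring grid points. By the Chapman--Kolmogorov equation of the heat kernel killed at \<open>0\<close>,
  the expectation of this product does not depend on \<open>n\<close>. On a continuous path it converges to \<open>1\<close>
  if the maximum is less than \<open>x\<close> and to \<open>0\<close> if it is greater, so Fatou's lemma, applied to the
  product and to its complement, gives the law of the maximum without a reflection principle.\<close>

section \<open>Heat kernel and bridge survival probability\<close>

text \<open>The path \<open>X1 t - X1 0 + (X2 1 - X2 t)\<close> starts almost surely at
  \<open>b2\<close>, ends almost surely at \<open>b1\<close> and has variance rate 1 + 1 = 2, which
  makes \<open>surv 2 (x - b2) (x - b1)\<close> the target. On the matrix side, \<open>x\<close>
  bounds the largest eigenvalue iff it is at least both diagonal entries and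
  \<open>Y1^2 + Z1^2\<close> is at most the same product \<open>(x - b2) * (x - b1)\<close>; the
  variance 1/2 is what makes this sum of squares exponential with rate exactly 1. Two obstacles
  shape the argument. The bridges are known only through their law on the product space, so only
  finitely many times can be used at once. And fixing the endpoint of a walk is conditioning on a
  null event: the computation for the free walk determines the bridge expectation for almost every
  endpoint only, and monotonicity in the endpoint is what extends it to every endpoint, in
  particular to \<open>b1 - b2\<close>.\<close>

definition heat :: "real \<Rightarrow> real \<Rightarrow> real" where
  "heat v x = normal_density 0 (sqrt v) x"

lemma heat_eq: "v > 0 \<Longrightarrow> heat v x = exp (- x\<^sup>2 / (2 * v)) / sqrt (2 * pi * v)"
  by (simp add: heat_def normal_density_def)

lemma heat_measurable [measurable]: "heat v \<in> borel_measurable borel"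
  unfolding heat_def by measurable

lemma heat_nonneg [simp]: "0 \<le> heat v x"
  by (simp add: heat_def)

lemma heat_pos: "v > 0 \<Longrightarrow> 0 < heat v x"
  by (simp add: heat_def normal_density_pos)

lemma heat_minus [simp]: "heat v (- x) = heat v x"
  by (simp add: heat_def normal_density_def)

lemma heat_diff:
  assumes "v > 0" shows "heat v (x - c) = heat v x * exp (c * x / v - c\<^sup>2 / (2 * v))"
proof -
  have "- (x - c)\<^sup>2 / (2 * v) = - x\<^sup>2 / (2 * v) + (c * x / v - c\<^sup>2 / (2 * v))"
    using assms by (simp add: field_simps power2_eq_square)
  then show ?thesis
    unfolding heat_eq[OF assms] by (simp only: exp_add times_divide_eq_left)
qed

lemma prob_space_heat: "v > 0 \<Longrightarrow> prob_space (density lborel (\<lambda>x. ennreal (heat v x)))"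
  unfolding heat_def by (rule prob_space_normal_density) simp

lemma nn_integral_heat:
  assumes "v > 0" shows "(\<integral>\<^sup>+x. heat v x \<partial>lborel) = 1"
  using prob_space.emeasure_space_1[OF prob_space_heat[OF assms]]
  by (simp add: emeasure_density)

lemma has_bochner_integral_heat_convolution:
  assumes "s > 0" "t > 0"
  shows "has_bochner_integral lborel (\<lambda>m. heat s (a - m) * heat t (m - b)) (heat (s + t) (a - b))"
proof (rule has_bochner_integral_nn_integral)
  have "(\<integral>\<^sup>+m. ennreal (heat s (a - m) * heat t (m - b)) \<partial>lborel)
      = (\<integral>\<^sup>+m. ennreal (heat s (a - b - m) * heat t m) \<partial>lborel)"
    by (subst nn_integral_real_affine[where c=1 and t=b]) (simp_all add: algebra_simps)
  also have "\<dots> = ennreal (heat (s + t) (a - b))"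
    using fun_cong[OF conv_normal_density_zero_mean[of "sqrt s" "sqrt t"], of "a - b"] assms
    by (simp add: heat_def)
  finally show "(\<integral>\<^sup>+m. ennreal (heat s (a - m) * heat t (m - b)) \<partial>lborel) = ennreal (heat (s + t) (a - b))" .
qed (auto simp: assms)

text \<open>The probability that a Brownian bridge of variance \<open>v\<close> from \<open>y\<close> to \<open>z\<close> stays positive.\<close>

definition surv :: "real \<Rightarrow> real \<Rightarrow> real \<Rightarrow> real" where
  "surv v y z = (if 0 < y \<and> 0 < z then 1 - exp (- (2 * y * z / v)) else 0)"

lemma surv_measurable [measurable]: "case_prod (surv v) \<in> borel_measurable (borel \<Otimes>\<^sub>M borel)"
  unfolding surv_def by measurable

lemma surv_nonneg [simp]: "v > 0 \<Longrightarrow> 0 \<le> surv v y z"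
  by (simp add: surv_def)

lemma surv_pos: "v > 0 \<Longrightarrow> y > 0 \<Longrightarrow> z > 0 \<Longrightarrow> surv v y z > 0"
  by (simp add: surv_def)

lemma surv_le_1: "surv v y z \<le> 1"
  by (simp add: surv_def)

lemma surv_mono:
  assumes "v > 0" "y \<le> y'" "z \<le> z'"
  shows "surv v y z \<le> surv v y' z'"
  using assms by (auto simp: surv_def intro!: divide_right_mono mult_mono)

text \<open>Method of images: reflecting \<open>z\<close> to \<open>- z\<close> multiplies the
  Gaussian by \<open>exp (- (2 * y * z / v))\<close>. The product is therefore the heat kernel on
  the half-line with absorption at 0, written as a difference of two free kernels.\<close>

lemma heat_times_surv:
  assumes "v > 0" "y > 0" "z > 0"
  shows "heat v (y - z) * surv v y z = heat v (y - z) - heat v (y + z)"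
proof -
  have "exp (- (y + z)\<^sup>2 / (2 * v)) = exp (- (y - z)\<^sup>2 / (2 * v)) * exp (- (2 * y * z / v))"
    unfolding exp_add[symmetric] using assms by (simp add: field_simps power2_eq_square)
  then show ?thesis
    using assms by (simp add: heat_eq surv_def field_simps)
qed

text \<open>The image formula makes each killed kernel an odd function of \<open>m\<close>, so their
  product \<open>k\<close> is even and vanishes at 0. Its integral over the whole line is a
  combination of four Gaussian convolutions, and the half-line integral of \<open>j\<close> is half
  of that.\<close>

lemma surv_chapman_kolmogorov:
  assumes "s > 0" "t > 0" "y > 0"
  shows "(\<integral>\<^sup>+m. ennreal (heat s (y - m) * surv s y m) * ennreal (heat t (m - z) * surv t m z) \<partial>lborel)
       = ennreal (heat (s + t) (y - z) * surv (s + t) y z)"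
proof (cases "z > 0")
  case False
  then show ?thesis by (simp add: surv_def)
next
  case True
  define k where "k m = (heat s (y - m) - heat s (y + m)) * (heat t (m - z) - heat t (m + z))" for m
  define j where "j m = heat s (y - m) * surv s y m * (heat t (m - z) * surv t m z)" for m
  have j_eq: "j m = indicator {0<..} m *\<^sub>R k m" for m
  proof (cases "m > 0")
    case True
    then show ?thesis
      using assms \<open>z > 0\<close> by (simp add: j_def k_def heat_times_surv)
  next
    case False
    then show ?thesis by (simp add: j_def surv_def)
  qed
  have k_eq: "k m = j m + j (- m)" for m
  proof -
    have "k (- m) = k m"
      using heat_minus[of t "m + z"] heat_minus[of t "m - z"]
      by (simp add: k_def algebra_simps)
    moreover have "k 0 = 0" by (simp add: k_def)
    ultimately show ?thesis by (cases m "0::real" rule: linorder_cases) (simp_all add: j_eq)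
  qed
  note conv = has_bochner_integral_heat_convolution[OF assms(1,2)]
  have "has_bochner_integral lborel
      (\<lambda>m. heat s (y - m) * heat t (m - z) - heat s (y - m) * heat t (m - - z)
         - (heat s (- y - m) * heat t (m - z) - heat s (- y - m) * heat t (m - - z)))
      (heat (s + t) (y - z) - heat (s + t) (y - - z)
         - (heat (s + t) (- y - z) - heat (s + t) (- y - - z)))"
    by (intro has_bochner_integral_diff conv)
  also have "(\<lambda>m. heat s (y - m) * heat t (m - z) - heat s (y - m) * heat t (m - - z)
         - (heat s (- y - m) * heat t (m - z) - heat s (- y - m) * heat t (m - - z))) = k"
  proof
    fix m
    have "heat s (- y - m) = heat s (y + m)"
      using heat_minus[of s "y + m"] by simp
    then show "heat s (y - m) * heat t (m - z) - heat s (y - m) * heat t (m - - z)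
         - (heat s (- y - m) * heat t (m - z) - heat s (- y - m) * heat t (m - - z)) = k m"
      by (simp add: k_def algebra_simps)
  qed
  also have "heat (s + t) (y - z) - heat (s + t) (y - - z)
         - (heat (s + t) (- y - z) - heat (s + t) (- y - - z))
       = 2 * (heat (s + t) (y - z) * surv (s + t) y z)"
    using heat_minus[of "s + t" "y + z"] heat_minus[of "s + t" "y - z"] True assms
      heat_times_surv[of "s + t" y z]
    by (simp add: algebra_simps)
  finally have k: "has_bochner_integral lborel k (2 * (heat (s + t) (y - z) * surv (s + t) y z))" .
  \<comment> \<open>\<open>j\<close> is \<open>k\<close> cut off to the half-line, so it inherits
    integrability; this allows the integral of \<open>k\<close> to be split into two equal
    halves.\<close>
  then have "integrable lborel j"
    unfolding j_eq by (intro integrable_mult_indicator) (auto intro: has_bochner_integral_integrable integrable.intros)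
  then have hj: "has_bochner_integral lborel j (integral\<^sup>L lborel j)"
    by (rule has_bochner_integral_integrable)
  moreover have "has_bochner_integral lborel (\<lambda>m. j (- m)) (integral\<^sup>L lborel j)"
    using lborel_has_bochner_integral_real_affine_iff[of "-1" j _ 0] hj by simp
  ultimately have "has_bochner_integral lborel k (integral\<^sup>L lborel j + integral\<^sup>L lborel j)"
    unfolding k_eq[abs_def] by (rule has_bochner_integral_add)
  with k have "integral\<^sup>L lborel j = heat (s + t) (y - z) * surv (s + t) y z"
    using has_bochner_integral_eq by fastforce
  moreover have "0 \<le> j m" for m
    using assms by (simp add: j_def)
  then have "(\<integral>\<^sup>+m. j m \<partial>lborel) = integral\<^sup>L lborel j"
    using \<open>integrable lborel j\<close> by (intro nn_integral_eq_integral) auto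
  ultimately show ?thesis
    using assms by (simp add: j_def ennreal_mult)
qed

section \<open>Gaussian random walks\<close>

abbreviation seq_space :: "nat \<Rightarrow> (nat \<Rightarrow> real) measure" where
  "seq_space n \<equiv> PiM {..<n} (\<lambda>_. borel)"

definition incs :: "nat \<Rightarrow> real \<Rightarrow> (nat \<Rightarrow> real) measure" where
  "incs n v = PiM {..<n} (\<lambda>_. density lborel (\<lambda>x. ennreal (heat v x)))"

lemma sets_incs [measurable_cong]: "sets (incs n v) = sets (seq_space n)"
  unfolding incs_def by (intro sets_PiM_cong) auto

lemma space_incs: "space (incs n v) = space (seq_space n)"
  by (rule sets_eq_imp_space_eq) (rule sets_incs)

lemma prob_space_incs:
  assumes "v > 0" shows "prob_space (incs n v)"
  unfolding incs_def by (intro prob_space_PiM prob_space_heat assms)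

text \<open>Splits off the last step with its density written out as a kernel; the inductions on the
  number of steps all run through this form.\<close>

lemma nn_integral_incs_Suc:
  assumes [measurable]: "f \<in> borel_measurable (seq_space (Suc n))" and "v > 0"
  shows "(\<integral>\<^sup>+d. f d \<partial>incs (Suc n) v) = (\<integral>\<^sup>+d. \<integral>\<^sup>+e. ennreal (heat v e) * f (d(n := e)) \<partial>lborel \<partial>incs n v)"
proof -
  let ?N = "density lborel (\<lambda>x. ennreal (heat v x))"
  interpret prob_space ?N by (rule prob_space_heat) fact
  interpret product_sigma_finite "\<lambda>_::nat. ?N"
    by standard
  have sets: "sets (PiM {..<Suc n} (\<lambda>_::nat. ?N)) = sets (seq_space (Suc n))"
    by (intro sets_PiM_cong) auto
  have "(\<integral>\<^sup>+d. f d \<partial>incs (Suc n) v) = (\<integral>\<^sup>+d. \<integral>\<^sup>+e. f (d(n := e)) \<partial>?N \<partial>incs n v)"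
    unfolding incs_def lessThan_Suc
    by (subst product_nn_integral_insert)
       (auto simp: lessThan_Suc[symmetric] cong: measurable_cong_sets[OF sets refl])
  also have "\<dots> = (\<integral>\<^sup>+d. \<integral>\<^sup>+e. ennreal (heat v e) * f (d(n := e)) \<partial>lborel \<partial>incs n v)"
  proof (intro nn_integral_cong nn_integral_density)
    fix d assume "d \<in> space (incs n v)"
    then have [measurable]: "d \<in> space (seq_space n)"
      by (simp add: space_incs)
    have "(\<lambda>e. d(n := e)) \<in> measurable borel (PiM (insert n {..<n}) (\<lambda>_. borel))"
      using \<open>d \<in> space (seq_space n)\<close> by (rule measurable_component_update) auto
    then show "(\<lambda>e. f (d(n := e))) \<in> borel_measurable lborel"
      by (auto simp: lessThan_Suc[symmetric])
  qed auto
  finally show ?thesis .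
qed

lemma nn_integral_incs_0: "(\<integral>\<^sup>+d. f d \<partial>incs 0 v) = f (\<lambda>_. undefined)"
  by (simp add: incs_def PiM_empty nn_integral_count_space_finite)

lemma measurable_update_seq_space [measurable]:
  "(\<lambda>(d, e). d(n := e)) \<in> measurable (seq_space n \<Otimes>\<^sub>M borel) (seq_space (Suc n))"
  unfolding lessThan_Suc by (rule measurable_add_dim)

lemma measurable_restrict_seq_space [measurable]:
  assumes [measurable]: "\<And>i. i < n \<Longrightarrow> f i \<in> borel_measurable M"
  shows "(\<lambda>x. \<lambda>i\<in>{..<n}. f i x) \<in> measurable M (seq_space n)"
  by (rule measurable_restrict) auto

text \<open>Translation formula for Gaussian measures, by \<open>heat_diff\<close> in each
  coordinate. Since all steps are shifted by the same \<open>c\<close>, the density depends on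
  \<open>d\<close> only through its sum, that is, through the endpoint of the walk.\<close>

lemma nn_integral_incs_shift:
  assumes "f \<in> borel_measurable (seq_space n)" and v: "v > 0"
  shows "(\<integral>\<^sup>+d. f (\<lambda>i\<in>{..<n}. d i + c) \<partial>incs n v)
       = (\<integral>\<^sup>+d. f d * ennreal (exp (c * (\<Sum>i<n. d i) / v - n * c\<^sup>2 / (2 * v))) \<partial>incs n v)"
  using assms(1)
proof (induction n arbitrary: f)
  case 0
  then show ?case by (simp add: nn_integral_incs_0 restrict_def del: nn_integral_const)
next
  case (Suc n)
  note [measurable] = Suc.prems
  define g where "g d = (\<integral>\<^sup>+e. ennreal (heat v e) * f (d(n := e + c)) \<partial>lborel)" for d
  have [measurable]: "g \<in> borel_measurable (seq_space n)"
    unfolding g_def by measurable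
  have upd: "restrict (\<lambda>i. (d(n := e)) i + c) {..<Suc n} = (restrict (\<lambda>i. d i + c) {..<n})(n := e + c)" for d e
    by (auto simp: fun_eq_iff restrict_def)
  have "(\<integral>\<^sup>+d. f (\<lambda>i\<in>{..<Suc n}. d i + c) \<partial>incs (Suc n) v)
      = (\<integral>\<^sup>+d. g (\<lambda>i\<in>{..<n}. d i + c) \<partial>incs n v)"
    by (subst nn_integral_incs_Suc[OF _ v]) (measurable, simp only: upd g_def)
  also have "\<dots> = (\<integral>\<^sup>+d. g d * ennreal (exp (c * (\<Sum>i<n. d i) / v - n * c\<^sup>2 / (2 * v))) \<partial>incs n v)"
    by (rule Suc.IH) measurable
  also have "\<dots> = (\<integral>\<^sup>+d. f d * ennreal (exp (c * (\<Sum>i<Suc n. d i) / v - Suc n * c\<^sup>2 / (2 * v))) \<partial>incs (Suc n) v)"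
  proof (subst nn_integral_incs_Suc[OF _ v], measurable, intro nn_integral_cong)
    fix d assume "d \<in> space (incs n v)"
    then have [measurable]: "d \<in> space (seq_space n)"
      by (simp add: space_incs)
    have "g d = (\<integral>\<^sup>+e. ennreal (heat v (e - c)) * f (d(n := e)) \<partial>lborel)"
      unfolding g_def by (subst (2) nn_integral_real_affine[where c=1 and t=c]) (simp_all add: algebra_simps)
    then have "g d * ennreal (exp (c * (\<Sum>i<n. d i) / v - n * c\<^sup>2 / (2 * v)))
      = (\<integral>\<^sup>+e. ennreal (heat v (e - c)) * f (d(n := e))
           * ennreal (exp (c * (\<Sum>i<n. d i) / v - n * c\<^sup>2 / (2 * v))) \<partial>lborel)"
      by (simp only:) (rule nn_integral_multc[symmetric], measurable)
    also have "\<dots> = (\<integral>\<^sup>+e. ennreal (heat v e) * (f (d(n := e))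
           * ennreal (exp (c * (\<Sum>i<Suc n. (d(n := e)) i) / v - Suc n * c\<^sup>2 / (2 * v)))) \<partial>lborel)"
    proof (rule nn_integral_cong)
      fix e :: real
      let ?E = "exp (c * (\<Sum>i<n. d i) / v - n * c\<^sup>2 / (2 * v))"
      let ?E' = "exp (c * (\<Sum>i<Suc n. (d(n := e)) i) / v - Suc n * c\<^sup>2 / (2 * v))"
      have "c * e / v - c\<^sup>2 / (2 * v) + (c * (\<Sum>i<n. d i) / v - n * c\<^sup>2 / (2 * v))
          = c * (\<Sum>i<Suc n. (d(n := e)) i) / v - Suc n * c\<^sup>2 / (2 * v)"
      proof -
        have "(\<Sum>i<Suc n. (d(n := e)) i) = (\<Sum>i<n. d i) + e"
          by simp
        then show ?thesis
          using v by (simp only: of_nat_Suc) (simp add: field_simps)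
      qed
      then have "heat v (e - c) * ?E = heat v e * ?E'"
        by (simp only: heat_diff[OF v] mult.assoc exp_add[symmetric])
      then have *: "ennreal (heat v (e - c)) * ennreal ?E = ennreal (heat v e) * ennreal ?E'"
        by (simp only: ennreal_mult'[symmetric] heat_nonneg)
      have "ennreal (heat v (e - c)) * f (d(n := e)) * ennreal ?E
          = f (d(n := e)) * (ennreal (heat v (e - c)) * ennreal ?E)"
        by (simp only: mult_ac)
      also have "\<dots> = ennreal (heat v e) * (f (d(n := e)) * ennreal ?E')"
        unfolding * by (simp only: mult_ac)
      finally show "ennreal (heat v (e - c)) * f (d(n := e)) * ennreal ?E
          = ennreal (heat v e) * (f (d(n := e)) * ennreal ?E')" .
    qed
    finally show "g d * ennreal (exp (c * (\<Sum>i<n. d i) / v - n * c\<^sup>2 / (2 * v))) =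
       (\<integral>\<^sup>+e. ennreal (heat v e) * (f (d(n := e))
           * ennreal (exp (c * (\<Sum>i<Suc n. (d(n := e)) i) / v - Suc n * c\<^sup>2 / (2 * v)))) \<partial>lborel)" .
  qed
  finally show ?case .
qed

section \<open>Walks pinned at their endpoint\<close>

lemma measurable_seq_space_component:
  "i < n \<Longrightarrow> f \<in> measurable M (seq_space n) \<Longrightarrow> (\<lambda>x. f x i) \<in> measurable M borel"
  by (rule measurable_compose[OF _ measurable_component_singleton]) auto

lemma measurable_seq_space_sum:
  fixes f :: "'a \<Rightarrow> nat \<Rightarrow> real"
  assumes "m \<le> n" "f \<in> measurable M (seq_space n)"
  shows "(\<lambda>x. \<Sum>i<m. f x i) \<in> borel_measurable M"
proof (rule borel_measurable_sum)
  fix i assume "i \<in> {..<m}"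
  with assms show "(\<lambda>x. f x i) \<in> borel_measurable M"
    by (intro measurable_seq_space_component) auto
qed

text \<open>Discrete form of \<open>B t - t * B 1 + a * t\<close>: the discrepancy between
  \<open>a\<close> and the actual endpoint is spread evenly over the steps, so for
  \<open>n > 0\<close> the new increments sum to \<open>a\<close>.\<close>

definition bridge_incs :: "nat \<Rightarrow> real \<Rightarrow> (nat \<Rightarrow> real) \<Rightarrow> nat \<Rightarrow> real" where
  "bridge_incs n a d = (\<lambda>i\<in>{..<n}. d i + (a - (\<Sum>j<n. d j)) / n)"

lemma measurable_bridge_incs [measurable]:
  "(\<lambda>(a, d). bridge_incs n a d) \<in> measurable (borel \<Otimes>\<^sub>M seq_space n) (seq_space n)"
proof -
  have [measurable]: "(\<lambda>x. snd x i) \<in> borel_measurable (borel \<Otimes>\<^sub>M seq_space n)" if "i < n" for i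
    using that measurable_snd by (rule measurable_seq_space_component)
  have [measurable]: "(\<lambda>x. \<Sum>i<n. snd x i) \<in> borel_measurable (borel \<Otimes>\<^sub>M seq_space n)"
    by (rule measurable_seq_space_sum[OF order_refl measurable_snd])
  show ?thesis
    unfolding bridge_incs_def split_beta by measurable
qed

text \<open>The Gaussian bridge obtained by recentring the walk is the walk conditioned on its endpoint:
  substitute \<open>u = \<Sum>d + n c\<close>, swap the integrals, and undo the shift by \<open>c\<close>.\<close>

lemma nn_integral_incs_disintegrate:
  fixes v :: real
  assumes [measurable]: "f \<in> borel_measurable (seq_space n)" "h \<in> borel_measurable borel"
    and n: "n > 0" and v: "v > 0"
  shows "(\<integral>\<^sup>+u. h u * ennreal (heat (n * v) u) * (\<integral>\<^sup>+d. f (bridge_incs n u d) \<partial>incs n v) \<partial>lborel)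
       = (\<integral>\<^sup>+d. h (\<Sum>i<n. d i) * f d \<partial>incs n v)"
proof -
  interpret prob_space "incs n v" by (rule prob_space_incs) fact
  interpret P: pair_sigma_finite "incs n v" lborel ..
  let ?S = "\<lambda>d. \<Sum>i<n. d i"
  let ?sh = "\<lambda>c d. \<lambda>i\<in>{..<n}. d i + c"
  have [measurable]: "(\<lambda>x. fst x i) \<in> borel_measurable (seq_space n \<Otimes>\<^sub>M borel)" if "i < n" for i
    using that measurable_fst by (rule measurable_seq_space_component)
  have [measurable]: "(\<lambda>x. ?sh (snd x) (fst x)) \<in> measurable (seq_space n \<Otimes>\<^sub>M borel) (seq_space n)"
    by measurable
  have [measurable]: "?S \<in> borel_measurable (seq_space n)"
    by (rule measurable_seq_space_sum) auto
  define k where "k d = h (?S d) * ennreal (heat (n * v) (?S d)) * f d" for d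
  have [measurable]: "k \<in> borel_measurable (seq_space n)"
    unfolding k_def by measurable
  have sum_sh: "?S (?sh c d) = ?S d + n * c" for c :: real and d
    by (simp add: sum.distrib)
  have "(\<integral>\<^sup>+u. h u * ennreal (heat (n * v) u) * (\<integral>\<^sup>+d. f (bridge_incs n u d) \<partial>incs n v) \<partial>lborel)
     = (\<integral>\<^sup>+u. \<integral>\<^sup>+d. h u * ennreal (heat (n * v) u) * f (bridge_incs n u d) \<partial>incs n v \<partial>lborel)"
    by (intro nn_integral_cong nn_integral_cmult[symmetric]) measurable
  also have "\<dots> = (\<integral>\<^sup>+d. \<integral>\<^sup>+u. h u * ennreal (heat (n * v) u) * f (bridge_incs n u d) \<partial>lborel \<partial>incs n v)"
    by (rule P.Fubini') measurable
  also have "\<dots> = (\<integral>\<^sup>+d. n * (\<integral>\<^sup>+c. k (?sh c d) \<partial>lborel) \<partial>incs n v)"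
  proof (rule nn_integral_cong)
    fix d assume "d \<in> space (incs n v)"
    then have d [measurable]: "d \<in> space (seq_space n)"
      by (simp add: space_incs)
    have "bridge_incs n (?S d + n * c) d = ?sh c d" for c :: real
      using n by (simp add: bridge_incs_def)
    then show "(\<integral>\<^sup>+u. h u * ennreal (heat (n * v) u) * f (bridge_incs n u d) \<partial>lborel)
        = n * (\<integral>\<^sup>+c. k (?sh c d) \<partial>lborel)"
      using n by (subst nn_integral_real_affine[where c=n and t="?S d"])
        (measurable, simp_all only: k_def sum_sh, simp_all add: ennreal_of_nat_eq_real_of_nat)
  qed
  also have "\<dots> = (\<integral>\<^sup>+d. \<integral>\<^sup>+c. n * k (?sh c d) \<partial>lborel \<partial>incs n v)"
    by (intro nn_integral_cong nn_integral_cmult[symmetric]) (auto simp: space_incs)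
  also have "\<dots> = (\<integral>\<^sup>+c. \<integral>\<^sup>+d. n * k (?sh c d) \<partial>incs n v \<partial>lborel)"
    by (rule P.Fubini'[symmetric]) measurable
  also have "\<dots> = (\<integral>\<^sup>+c. \<integral>\<^sup>+d. n * k d * ennreal (exp (c * ?S d / v - n * c\<^sup>2 / (2 * v))) \<partial>incs n v \<partial>lborel)"
    by (intro nn_integral_cong nn_integral_incs_shift v) measurable
  also have "\<dots> = (\<integral>\<^sup>+d. \<integral>\<^sup>+c. n * k d * ennreal (exp (c * ?S d / v - n * c\<^sup>2 / (2 * v))) \<partial>lborel \<partial>incs n v)"
    by (rule P.Fubini') measurable
  also have "\<dots> = (\<integral>\<^sup>+d. h (?S d) * f d \<partial>incs n v)"
  proof (rule nn_integral_cong)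
    fix d :: "nat \<Rightarrow> real"
    \<comment> \<open>Completing the square: the tilt moves the argument of the endpoint density by
      \<open>n * c\<close>. Integrating over \<open>c\<close> then gives \<open>1 / n\<close>, which
      cancels the Jacobian \<open>n\<close> of the substitution.\<close>
    have eq: "ennreal (heat (n * v) (?S d)) * ennreal (exp (c * ?S d / v - n * c\<^sup>2 / (2 * v)))
        = ennreal (heat (n * v) (?S d + (- real n) * c))" for c :: real
    proof -
      have "(n * c) * ?S d / (n * v) - (n * c)\<^sup>2 / (2 * (n * v)) = c * ?S d / v - n * c\<^sup>2 / (2 * v)"
        using n by (simp add: power2_eq_square)
      then show ?thesis
        using heat_diff[of "n * v" "?S d" "n * c"] n v by (simp add: ennreal_mult'[symmetric])
    qed
    have "(\<integral>\<^sup>+c. n * k d * ennreal (exp (c * ?S d / v - n * c\<^sup>2 / (2 * v))) \<partial>lborel)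
       = (\<integral>\<^sup>+c. (h (?S d) * f d * n) * ennreal (heat (n * v) (?S d + (- real n) * c)) \<partial>lborel)"
      unfolding k_def eq[symmetric] by (simp only: mult_ac)
    also have "\<dots> = h (?S d) * f d * (n * (\<integral>\<^sup>+c. ennreal (heat (n * v) (?S d + (- real n) * c)) \<partial>lborel))"
      by (subst nn_integral_cmult) (measurable, simp only: mult_ac)
    also have "n * (\<integral>\<^sup>+c. ennreal (heat (n * v) (?S d + (- real n) * c)) \<partial>lborel)
       = (\<integral>\<^sup>+x. ennreal (heat (n * v) x) \<partial>lborel)"
      using n by (subst (2) nn_integral_real_affine[where c="- real n" and t="?S d"])
        (auto simp: ennreal_of_nat_eq_real_of_nat)
    also have "\<dots> = 1"
      using n v by (intro nn_integral_heat) simp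
    finally show "(\<integral>\<^sup>+c. n * k d * ennreal (exp (c * ?S d / v - n * c\<^sup>2 / (2 * v))) \<partial>lborel) = h (?S d) * f d"
      by simp
  qed
  finally show ?thesis .
qed

section \<open>Survival of walks and of pinned walks\<close>

definition surv_walk :: "nat \<Rightarrow> real \<Rightarrow> real \<Rightarrow> (nat \<Rightarrow> real) \<Rightarrow> real" where
  "surv_walk n v y d = (\<Prod>i<n. surv v (y - (\<Sum>j<i. d j)) (y - (\<Sum>j<Suc i. d j)))"

lemma surv_walk_nonneg [simp]: "v > 0 \<Longrightarrow> 0 \<le> surv_walk n v y d"
  by (simp add: surv_walk_def prod_nonneg)

lemma measurable_surv_walk [measurable]:
  "surv_walk n v y \<in> borel_measurable (seq_space n)"
  unfolding surv_walk_def
proof (rule borel_measurable_prod)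
  fix i assume "i \<in> {..<n}"
  then have [measurable]: "(\<lambda>d. \<Sum>j<i. d j :: real) \<in> borel_measurable (seq_space n)"
    "(\<lambda>d. \<Sum>j<Suc i. d j :: real) \<in> borel_measurable (seq_space n)"
    by (auto intro!: measurable_seq_space_sum[where n=n and f="\<lambda>x. x"] simp del: sum.lessThan_Suc)
  show "(\<lambda>d. surv v (y - (\<Sum>j<i. d j)) (y - (\<Sum>j<Suc i. d j))) \<in> borel_measurable (seq_space n)"
    by measurable
qed

lemma surv_walk_Suc_update:
  "surv_walk (Suc n) v y (d(n := e))
   = surv_walk n v y d * surv v (y - (\<Sum>j<n. d j)) (y - (\<Sum>j<n. d j) - e)"
proof -
  have "(\<Sum>j<i. (d(n := e)) j) = (\<Sum>j<i. d j)" if "i \<le> n" for i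
    using that by (intro sum.cong) auto
  then show ?thesis
    by (simp add: surv_walk_def Suc_le_eq algebra_simps del: sum.lessThan_Suc fun_upd_apply)
       (simp add: algebra_simps)
qed

text \<open>The walk weighted by its survival factors is a Markov chain with the killed heat kernel
  as transition density, and by Chapman-Kolmogorov its density after all steps is the killed kernel
  at the total time. An arbitrary \<open>h\<close> keeps the induction going; there is at least one
  step because after zero steps the position is a point mass without density.\<close>

lemma nn_integral_surv_walk_Suc:
  fixes h :: "real \<Rightarrow> ennreal" and v y :: real
  assumes "h \<in> borel_measurable borel" and y: "y > 0" and v: "v > 0"
  shows "(\<integral>\<^sup>+d. surv_walk (Suc n) v y d * h (y - (\<Sum>j<Suc n. d j)) \<partial>incs (Suc n) v)
       = (\<integral>\<^sup>+z. ennreal (heat (Suc n * v) (y - z) * surv (Suc n * v) y z) * h z \<partial>lborel)"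
  using assms(1)
proof (induction n arbitrary: h)
  case 0
  note [measurable] = 0
  have "(\<integral>\<^sup>+d. surv_walk (Suc 0) v y d * h (y - (\<Sum>j<Suc 0. d j)) \<partial>incs (Suc 0) v)
      = (\<integral>\<^sup>+e. ennreal (heat v e) * (surv v y (y - e) * h (y - e)) \<partial>lborel)"
    by (subst nn_integral_incs_Suc[OF _ v]) (measurable, simp add: nn_integral_incs_0 surv_walk_def prob_space.emeasure_space_1[OF prob_space_incs[OF v]])
  also have "\<dots> = (\<integral>\<^sup>+z. ennreal (heat v (y - z)) * (surv v y z * h z) \<partial>lborel)"
    by (subst nn_integral_real_affine[where c="-1" and t=y]) auto
  finally show ?case
    using v by (simp add: ennreal_mult mult.assoc)
next
  case (Suc n)
  note [measurable] = Suc.prems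
  let ?m = "Suc n"
  \<comment> \<open>One step of the killed semigroup applied to \<open>h\<close>; the induction
    hypothesis is used for this function instead of \<open>h\<close>.\<close>
  define h' where "h' x = (\<integral>\<^sup>+z. ennreal (heat v (x - z) * surv v x z) * h z \<partial>lborel)" for x
  have [measurable]: "h' \<in> borel_measurable borel"
    unfolding h'_def by measurable
  have "(\<integral>\<^sup>+d. surv_walk (Suc ?m) v y d * h (y - (\<Sum>j<Suc ?m. d j)) \<partial>incs (Suc ?m) v)
      = (\<integral>\<^sup>+d. surv_walk ?m v y d * h' (y - (\<Sum>j<?m. d j)) \<partial>incs ?m v)"
  proof (subst nn_integral_incs_Suc[OF _ v], measurable, rule nn_integral_cong)
    fix d :: "nat \<Rightarrow> real"
    let ?x = "y - (\<Sum>j<?m. d j)"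
    have sum: "y - (\<Sum>j<Suc ?m. (d(?m := e)) j) = ?x - e" for e
      by (simp add: algebra_simps)
    have "(\<integral>\<^sup>+e. ennreal (heat v e) * (surv_walk (Suc ?m) v y (d(?m := e)) * h (y - (\<Sum>j<Suc ?m. (d(?m := e)) j))) \<partial>lborel)
        = (\<integral>\<^sup>+e. surv_walk ?m v y d * (ennreal (heat v e * surv v ?x (?x - e)) * h (?x - e)) \<partial>lborel)"
      using v by (simp only: surv_walk_Suc_update sum) (simp add: ennreal_mult mult_ac)
    also have "\<dots> = surv_walk ?m v y d * (\<integral>\<^sup>+e. (ennreal (heat v e * surv v ?x (?x - e)) * h (?x - e)) \<partial>lborel)"
      by (rule nn_integral_cmult) measurable
    also have "(\<integral>\<^sup>+e. (ennreal (heat v e * surv v ?x (?x - e)) * h (?x - e)) \<partial>lborel) = h' ?x"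
      unfolding h'_def by (subst nn_integral_real_affine[where c="-1" and t="?x"]) auto
    finally show "(\<integral>\<^sup>+e. ennreal (heat v e) * (surv_walk (Suc ?m) v y (d(?m := e)) * h (y - (\<Sum>j<Suc ?m. (d(?m := e)) j))) \<partial>lborel)
        = ennreal (surv_walk ?m v y d) * h' ?x" .
  qed
  also have "\<dots> = (\<integral>\<^sup>+m. ennreal (heat (?m * v) (y - m) * surv (?m * v) y m) * h' m \<partial>lborel)"
    by (rule Suc.IH) measurable
  also have "\<dots> = (\<integral>\<^sup>+m. \<integral>\<^sup>+z. ennreal (heat (?m * v) (y - m) * surv (?m * v) y m) * (ennreal (heat v (m - z) * surv v m z) * h z) \<partial>lborel \<partial>lborel)"
    unfolding h'_def by (intro nn_integral_cong nn_integral_cmult[symmetric]) measurable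
  also have "\<dots> = (\<integral>\<^sup>+z. \<integral>\<^sup>+m. ennreal (heat (?m * v) (y - m) * surv (?m * v) y m) * (ennreal (heat v (m - z) * surv v m z) * h z) \<partial>lborel \<partial>lborel)"
    by (rule lborel_pair.Fubini') measurable
  also have "\<dots> = (\<integral>\<^sup>+z. (\<integral>\<^sup>+m. ennreal (heat (?m * v) (y - m) * surv (?m * v) y m) * ennreal (heat v (m - z) * surv v m z) \<partial>lborel) * h z \<partial>lborel)"
    unfolding mult.assoc[symmetric] by (intro nn_integral_cong nn_integral_multc) measurable
  also have "\<dots> = (\<integral>\<^sup>+z. ennreal (heat (Suc ?m * v) (y - z) * surv (Suc ?m * v) y z) * h z \<partial>lborel)"
  proof -
    have "?m * v + v = Suc ?m * v" by (simp add: algebra_simps)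
    then show ?thesis
      using v y surv_chapman_kolmogorov[of "?m * v" v y] by simp
  qed
  finally show ?case .
qed

text \<open>A higher endpoint raises every partial sum and so lowers every distance to the level.
  This monotonicity later removes an exceptional null set of endpoints.\<close>

lemma surv_walk_bridge_antimono:
  assumes "v > 0" "u \<le> u'"
  shows "surv_walk n v y (bridge_incs n u' d) \<le> surv_walk n v y (bridge_incs n u d)"
proof -
  have "(\<Sum>j<i. bridge_incs n u d j) \<le> (\<Sum>j<i. bridge_incs n u' d j)" if "i \<le> n" for i
    using assms that by (intro sum_mono) (auto simp: bridge_incs_def intro!: divide_right_mono)
  then show ?thesis
    unfolding surv_walk_def using assms
    by (intro prod_mono conjI surv_mono diff_left_mono surv_nonneg) (auto simp del: sum.lessThan_Suc)
qed

text \<open>A null set contains no interval, so points of agreement accumulate at \<open>x\<close>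
  from both sides. Those on the left give \<open>f x <= g x\<close> in the limit, those on the right
  the converse.\<close>

lemma AE_eq_antimono_continuous:
  fixes f g :: "real \<Rightarrow> ennreal"
  assumes f: "antimono f" and g: "continuous_on UNIV g" and eq: "AE x in lborel. f x = g x"
  shows "f x = g x"
proof -
  have dense: "\<exists>x\<in>{a<..<b}. f x = g x" if "a < b" for a b
  proof (rule ccontr)
    assume "\<not> ?thesis"
    with eq have "AE x in lborel. x \<notin> {a<..<b}"
      by (auto elim!: eventually_mono)
    then have "emeasure lborel {a<..<b} = 0"
      by (subst (asm) AE_iff_measurable[where N="{a<..<b}"]) auto
    with that show False by simp
  qed
  have tend: "(\<lambda>k. g (s k)) \<longlonglongrightarrow> g x" if "s \<longlonglongrightarrow> x" for s
    using g that by (auto simp: continuous_on_eq_continuous_at isCont_tendsto_compose)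
  have e: "(\<lambda>k. inverse (real (Suc k))) \<longlonglongrightarrow> 0"
    by (rule LIMSEQ_inverse_real_of_nat)
  have "\<forall>k. \<exists>z. z \<in> {x - inverse (real (Suc k))<..<x} \<and> f z = g z"
    using dense[of "x - inverse (real (Suc _))" x] by (auto simp: Bex_def)
  from choice[OF this] obtain s where s: "\<And>k. s k \<in> {x - inverse (real (Suc k))<..<x}" "\<And>k. f (s k) = g (s k)"
    by blast
  have "s \<longlonglongrightarrow> x"
    by (rule tendsto_sandwich[of "\<lambda>k. x - inverse (real (Suc k))" _ _ "\<lambda>_. x"])
       (use s(1) tendsto_diff[OF tendsto_const e, of x] in \<open>auto intro!: always_eventually less_imp_le\<close>)
  then have "f x \<le> g x"
    by (intro LIMSEQ_le_const[OF tend]) (use s f in \<open>auto simp: antimono_def less_imp_le simp flip: s(2)\<close>)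
  have "\<forall>k. \<exists>z. z \<in> {x<..<x + inverse (real (Suc k))} \<and> f z = g z"
    using dense[of x "x + inverse (real (Suc _))"] by (auto simp: Bex_def)
  from choice[OF this] obtain s where s: "\<And>k. s k \<in> {x<..<x + inverse (real (Suc k))}" "\<And>k. f (s k) = g (s k)"
    by blast
  have "s \<longlonglongrightarrow> x"
    by (rule tendsto_sandwich[of "\<lambda>_. x" _ _ "\<lambda>k. x + inverse (real (Suc k))"])
       (use s(1) tendsto_add[OF tendsto_const e, of x] in \<open>auto intro!: always_eventually less_imp_le\<close>)
  then have "g x \<le> f x"
    by (intro LIMSEQ_le_const2[OF tend]) (use s f in \<open>auto simp: antimono_def less_imp_le simp flip: s(2)\<close>)
  with \<open>f x \<le> g x\<close> show ?thesis by simp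
qed

text \<open>Both sides, multiplied by the Gaussian density of the endpoint, are densities of the
  same measure: the endpoint law of the free walk weighted by survival. Uniqueness of densities
  gives equality for almost every \<open>u\<close>; the left side is antimonotone and the right side
  continuous in \<open>u\<close>, hence equality everywhere.\<close>

lemma nn_integral_surv_walk_bridge:
  fixes v y u :: real
  assumes y: "y > 0" and v: "v > 0" and n: "n > 0"
  shows "(\<integral>\<^sup>+d. surv_walk n v y (bridge_incs n u d) \<partial>incs n v) = ennreal (surv (n * v) y (y - u))"
proof -
  interpret prob_space "incs n v" by (rule prob_space_incs) fact
  obtain m where m: "n = Suc m" using n by (cases n) auto
  have nv: "n * v > 0" using n v by simp
  define \<phi> where "\<phi> u = (\<integral>\<^sup>+d. surv_walk n v y (bridge_incs n u d) \<partial>incs n v)" for u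
  have [measurable]: "\<phi> \<in> borel_measurable borel"
    unfolding \<phi>_def by measurable
  have "density lborel (\<lambda>u. ennreal (heat (n * v) u) * \<phi> u)
      = density lborel (\<lambda>u. ennreal (heat (n * v) u) * ennreal (surv (n * v) y (y - u)))"
  proof (rule measure_eqI)
    fix A assume "A \<in> sets (density lborel (\<lambda>u. ennreal (heat (n * v) u) * \<phi> u))"
    then have [measurable]: "A \<in> sets borel" by simp
    have "emeasure (density lborel (\<lambda>u. ennreal (heat (n * v) u) * \<phi> u)) A
      = (\<integral>\<^sup>+u. indicator A u * ennreal (heat (n * v) u) * (\<integral>\<^sup>+d. surv_walk n v y (bridge_incs n u d) \<partial>incs n v) \<partial>lborel)"
      by (simp add: emeasure_density \<phi>_def mult_ac)
    also have "\<dots> = (\<integral>\<^sup>+d. indicator A (\<Sum>i<n. d i) * ennreal (surv_walk n v y d) \<partial>incs n v)"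
      by (rule nn_integral_incs_disintegrate) (use n v in measurable)
    also have "\<dots> = (\<integral>\<^sup>+d. ennreal (surv_walk n v y d) * indicator A (y - (y - (\<Sum>i<n. d i))) \<partial>incs n v)"
      by (simp add: mult.commute)
    also have "\<dots> = (\<integral>\<^sup>+z. ennreal (heat (n * v) (y - z) * surv (n * v) y z) * indicator A (y - z) \<partial>lborel)"
      unfolding m by (rule nn_integral_surv_walk_Suc[where h="\<lambda>x. indicator A (y - x)"]) (use y v in measurable)
    also have "\<dots> = (\<integral>\<^sup>+u. ennreal (heat (n * v) u * surv (n * v) y (y - u)) * indicator A u \<partial>lborel)"
      by (subst (2) nn_integral_real_affine[where c="-1" and t=y]) auto
    also have "\<dots> = emeasure (density lborel (\<lambda>u. ennreal (heat (n * v) u) * ennreal (surv (n * v) y (y - u)))) A"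
      using nv by (simp add: emeasure_density ennreal_mult)
    finally show "emeasure (density lborel (\<lambda>u. ennreal (heat (n * v) u) * \<phi> u)) A
      = emeasure (density lborel (\<lambda>u. ennreal (heat (n * v) u) * ennreal (surv (n * v) y (y - u)))) A" .
  qed simp
  then have "AE u in lborel. ennreal (heat (n * v) u) * \<phi> u = ennreal (heat (n * v) u) * ennreal (surv (n * v) y (y - u))"
    by (intro sigma_finite_measure.density_unique[OF sigma_finite_lborel]) auto
  then have ae: "AE u in lborel. \<phi> u = ennreal (surv (n * v) y (y - u))"
    using heat_pos[OF nv] by (auto elim!: eventually_mono simp: ennreal_mult_cancel_left less_imp_neq[symmetric])
  have "antimono \<phi>"
    unfolding \<phi>_def antimono_def
    by (intro allI impI nn_integral_mono ennreal_leI surv_walk_bridge_antimono v)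
  moreover have "continuous_on UNIV (\<lambda>u. ennreal (surv (n * v) y (y - u)))"
  proof -
    \<comment> \<open>Since \<open>y > 0\<close>, the case distinction in \<open>surv\<close> is a
      cut-off at 0, which exhibits continuity across \<open>u = y\<close>.\<close>
    have "surv (n * v) y (y - u) = max 0 (1 - exp (- (2 * y * (y - u) / (n * v))))" for u
      using y nv v n by (auto simp: surv_def max_def divide_le_0_iff mult_le_0_iff zero_le_divide_iff zero_le_mult_iff)
    then show ?thesis
      using n v by (simp only:) (intro continuous_on_ennreal continuous_intros, auto)
  qed
  ultimately show ?thesis
    using AE_eq_antimono_continuous[OF _ _ ae, of u] by (simp add: \<phi>_def[of u])
qed

section \<open>Differences of independent Gaussian walks\<close>

lemma nn_integral_heat_diff:
  fixes f :: "real \<Rightarrow> ennreal"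
  assumes [measurable]: "f \<in> borel_measurable borel" and v: "v > 0" and w: "w > 0"
  shows "(\<integral>\<^sup>+e. \<integral>\<^sup>+e'. ennreal (heat v e) * (ennreal (heat w e') * f (e - e')) \<partial>lborel \<partial>lborel)
       = (\<integral>\<^sup>+z. ennreal (heat (v + w) z) * f z \<partial>lborel)"
proof -
  have "(\<integral>\<^sup>+e. \<integral>\<^sup>+e'. ennreal (heat v e) * (ennreal (heat w e') * f (e - e')) \<partial>lborel \<partial>lborel)
      = (\<integral>\<^sup>+e. \<integral>\<^sup>+z. ennreal (heat v e) * (ennreal (heat w (e - z)) * f z) \<partial>lborel \<partial>lborel)"
  proof (rule nn_integral_cong)
    fix e :: real
    show "(\<integral>\<^sup>+e'. ennreal (heat v e) * (ennreal (heat w e') * f (e - e')) \<partial>lborel)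
        = (\<integral>\<^sup>+z. ennreal (heat v e) * (ennreal (heat w (e - z)) * f z) \<partial>lborel)"
      by (subst nn_integral_real_affine[where c="-1" and t=e]) auto
  qed
  also have "\<dots> = (\<integral>\<^sup>+z. \<integral>\<^sup>+e. ennreal (heat v e) * (ennreal (heat w (e - z)) * f z) \<partial>lborel \<partial>lborel)"
    by (rule lborel_pair.Fubini') measurable
  also have "\<dots> = (\<integral>\<^sup>+z. ennreal (heat (v + w) z) * f z \<partial>lborel)"
  proof (rule nn_integral_cong)
    fix z :: real
    have "(\<integral>\<^sup>+e. ennreal (heat v e) * (ennreal (heat w (e - z)) * f z) \<partial>lborel)
        = (\<integral>\<^sup>+e. ennreal (heat v (0 - e) * heat w (e - z)) * f z \<partial>lborel)"
      by (simp add: ennreal_mult mult.assoc)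
    also have "\<dots> = (\<integral>\<^sup>+e. ennreal (heat v (0 - e) * heat w (e - z)) \<partial>lborel) * f z"
      by (rule nn_integral_multc) measurable
    also have "(\<integral>\<^sup>+e. ennreal (heat v (0 - e) * heat w (e - z)) \<partial>lborel) = ennreal (heat (v + w) z)"
      using nn_integral_eq_integral[OF integrable.intros[OF has_bochner_integral_heat_convolution[OF v w, of 0 z]]]
        has_bochner_integral_integral_eq[OF has_bochner_integral_heat_convolution[OF v w, of 0 z]]
      by simp
    finally show "(\<integral>\<^sup>+e. ennreal (heat v e) * (ennreal (heat w (e - z)) * f z) \<partial>lborel)
        = ennreal (heat (v + w) z) * f z" .
  qed
  finally show ?thesis .
qed

text \<open>Variances add step by step. This merges the two bridges into one: with
  \<open>1 / n\<close> for each of them, the difference has step variance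
  \<open>2 / n\<close>.\<close>

lemma nn_integral_incs_diff:
  assumes "f \<in> borel_measurable (seq_space n)" and v: "v > 0" and w: "w > 0"
  shows "(\<integral>\<^sup>+d. \<integral>\<^sup>+d'. f (\<lambda>i\<in>{..<n}. d i - d' i) \<partial>incs n w \<partial>incs n v) = (\<integral>\<^sup>+d. f d \<partial>incs n (v + w))"
  using assms(1)
proof (induction n arbitrary: f)
  case 0
  then show ?case by (simp add: nn_integral_incs_0 restrict_def del: nn_integral_const)
next
  case (Suc n)
  note [measurable] = Suc.prems
  interpret V: prob_space "incs n v" by (rule prob_space_incs) fact
  interpret W: prob_space "incs n w" by (rule prob_space_incs) fact
  interpret W': prob_space "incs (Suc n) w" by (rule prob_space_incs) fact
  interpret P: pair_sigma_finite lborel "incs n w" ..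
  define g where "g d = (\<integral>\<^sup>+e. \<integral>\<^sup>+e'. ennreal (heat v e) * (ennreal (heat w e') * f (d(n := e - e'))) \<partial>lborel \<partial>lborel)" for d
  have [measurable]: "g \<in> borel_measurable (seq_space n)"
    unfolding g_def by measurable
  have [measurable]: "(\<lambda>x. fst x i) \<in> borel_measurable (seq_space m \<Otimes>\<^sub>M seq_space m)"
     "(\<lambda>x. snd x i) \<in> borel_measurable (seq_space m \<Otimes>\<^sub>M seq_space m)" if "i < m" for i and m :: nat
    using measurable_seq_space_component[OF that measurable_fst] measurable_seq_space_component[OF that measurable_snd] .
  have upd: "(\<lambda>i\<in>{..<Suc n}. (d(n := e)) i - (d'(n := e')) i) = (\<lambda>i\<in>{..<n}. d i - d' i)(n := e - e')" for d d' e e'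
    by (auto simp: fun_eq_iff restrict_def)
  have [measurable]: "(\<lambda>x. \<lambda>i\<in>{..<m}. fst x i - snd x i) \<in> measurable
      (seq_space m \<Otimes>\<^sub>M seq_space m) (seq_space m)" for m
    by measurable
  have "(\<integral>\<^sup>+d. \<integral>\<^sup>+d'. f (\<lambda>i\<in>{..<Suc n}. d i - d' i) \<partial>incs (Suc n) w \<partial>incs (Suc n) v)
      = (\<integral>\<^sup>+d. \<integral>\<^sup>+e. ennreal (heat v e) * (\<integral>\<^sup>+d'. f (\<lambda>i\<in>{..<Suc n}. (d(n := e)) i - d' i) \<partial>incs (Suc n) w) \<partial>lborel \<partial>incs n v)"
    by (rule nn_integral_incs_Suc[OF _ v]) measurable
  also have "\<dots> = (\<integral>\<^sup>+d. \<integral>\<^sup>+e. ennreal (heat v e) * (\<integral>\<^sup>+d'. \<integral>\<^sup>+e'. ennreal (heat w e') * f ((\<lambda>i\<in>{..<n}. d i - d' i)(n := e - e')) \<partial>lborel \<partial>incs n w) \<partial>lborel \<partial>incs n v)"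
    by (intro nn_integral_cong, subst nn_integral_incs_Suc[OF _ w]) (measurable, simp only: upd)
  also have "\<dots> = (\<integral>\<^sup>+d. \<integral>\<^sup>+e. \<integral>\<^sup>+d'. \<integral>\<^sup>+e'. ennreal (heat v e) * (ennreal (heat w e') * f ((\<lambda>i\<in>{..<n}. d i - d' i)(n := e - e'))) \<partial>lborel \<partial>incs n w \<partial>lborel \<partial>incs n v)"
    by (intro nn_integral_cong, subst nn_integral_cmult[symmetric], measurable)
      (intro nn_integral_cong nn_integral_cmult[symmetric], measurable)
  \<comment> \<open>Exchanging \<open>e\<close> with the earlier steps \<open>d'\<close> brings the
    two last steps together, where \<open>g\<close> collects them.\<close>
  also have "\<dots> = (\<integral>\<^sup>+d. \<integral>\<^sup>+d'. g (\<lambda>i\<in>{..<n}. d i - d' i) \<partial>incs n w \<partial>incs n v)"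
    unfolding g_def by (intro nn_integral_cong P.Fubini'[symmetric]) measurable
  also have "\<dots> = (\<integral>\<^sup>+d. g d \<partial>incs n (v + w))"
    by (rule Suc.IH) measurable
  also have "\<dots> = (\<integral>\<^sup>+d. f d \<partial>incs (Suc n) (v + w))"
  proof (subst nn_integral_incs_Suc[OF _ add_pos_pos[OF v w]], measurable, rule nn_integral_cong)
    fix d assume "d \<in> space (incs n (v + w))"
    then have [measurable]: "d \<in> space (seq_space n)"
      by (simp add: space_incs)
    show "g d = (\<integral>\<^sup>+z. ennreal (heat (v + w) z) * f (d(n := z)) \<partial>lborel)"
      unfolding g_def by (rule nn_integral_heat_diff[OF _ v w]) measurable
  qed
  finally show ?case .
qed

section \<open>Brownian bridges on a grid\<close>

definition path_incs :: "nat \<Rightarrow> (real \<Rightarrow> real) \<Rightarrow> nat \<Rightarrow> real" where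
  "path_incs n p = (\<lambda>i\<in>{..<n}. p (Suc i / n) - p (i / n))"

lemma measurable_path_incs [measurable]:
  "path_incs n \<in> measurable path_space01 (seq_space n)"
proof -
  have [measurable]: "(\<lambda>p. p (i / n)) \<in> borel_measurable path_space01" if "i \<le> n" for i
    using that by (intro measurable_component_singleton) (auto simp: divide_le_eq_1)
  show ?thesis
    unfolding path_incs_def by (rule measurable_restrict_seq_space) (auto intro!: borel_measurable_diff simp: Suc_le_eq)
qed

lemma path_incs_path01:
  "path_incs n (path01 X \<omega>) = (\<lambda>i\<in>{..<n}. X (Suc i / n) \<omega> - X (i / n) \<omega>)"
  by (auto simp: path_incs_def path01_def fun_eq_iff divide_le_eq_1)

lemma distr_brownian_motion_incs:
  assumes bm: "standard_brownian_motion N B" and n: "n > 0"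
  shows "distr N (seq_space n) (\<lambda>\<omega>. \<lambda>i\<in>{..<n}. B (Suc i / n) \<omega> - B (i / n) \<omega>) = incs n (1 / n)"
proof -
  interpret prob_space N
    using bm by (simp add: standard_brownian_motion_def)
  let ?\<tau> = "\<lambda>i::nat. i / n :: real"
  have [measurable]: "B t \<in> borel_measurable N" if "t \<ge> 0" for t
    using bm that by (simp add: standard_brownian_motion_def)
  have step: "?\<tau> i < ?\<tau> (Suc i)" for i
    using n by (simp add: divide_strict_right_mono)
  have indep: "indep_vars (\<lambda>_. borel) (\<lambda>i \<omega>. B (?\<tau> (Suc i)) \<omega> - B (?\<tau> i) \<omega>) {..<n}"
  proof -
    from bm have "\<forall>(n::nat) (\<tau> :: nat \<Rightarrow> real). 0 \<le> \<tau> 0 \<and> (\<forall>i<n. \<tau> i < \<tau> (Suc i)) \<longrightarrow>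
        indep_vars (\<lambda>_. borel) (\<lambda>i \<omega>. B (\<tau> (Suc i)) \<omega> - B (\<tau> i) \<omega>) {..<n}"
      unfolding standard_brownian_motion_def by (elim conjE)
    then show ?thesis
      by (elim allE[of _ n] allE[of _ ?\<tau>]) (use step in simp)
  qed
  have normal: "distr N borel (\<lambda>\<omega>. B (?\<tau> (Suc i)) \<omega> - B (?\<tau> i) \<omega>) = density lborel (heat (1 / n))" for i
  proof -
    have "distributed N lborel (\<lambda>\<omega>. B (?\<tau> (Suc i)) \<omega> - B (?\<tau> i) \<omega>) (normal_density 0 (sqrt (?\<tau> (Suc i) - ?\<tau> i)))"
      using bm step[of i] unfolding standard_brownian_motion_def by (simp del: of_nat_Suc)
    moreover have "?\<tau> (Suc i) - ?\<tau> i = 1 / n"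
      by (simp add: add_divide_distrib)
    ultimately have "distr N lborel (\<lambda>\<omega>. B (?\<tau> (Suc i)) \<omega> - B (?\<tau> i) \<omega>) = density lborel (heat (1 / n))"
      unfolding heat_def by (simp add: distributed_distr_eq_density)
    then show ?thesis
      by (subst distr_cong[OF refl sets_lborel[symmetric] refl]) simp_all
  qed
  have "distr N (seq_space n) (\<lambda>\<omega>. \<lambda>i\<in>{..<n}. B (?\<tau> (Suc i)) \<omega> - B (?\<tau> i) \<omega>)
      = PiM {..<n} (\<lambda>i. distr N borel (\<lambda>\<omega>. B (?\<tau> (Suc i)) \<omega> - B (?\<tau> i) \<omega>))"
    using n by (intro indep_vars_iff_distr_eq_PiM'[THEN iffD1, OF _ _ indep]) auto
  also have "\<dots> = incs n (1 / n)"
    unfolding incs_def normal ..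
  finally show ?thesis .
qed

text \<open>The correction \<open>- t * B 1 + b * t\<close> adds \<open>(b - B 1) / n\<close> to
  each grid increment, and \<open>B 1\<close> is the sum of the increments of \<open>B\<close>
  because \<open>B 0\<close> vanishes. The latter holds only almost surely, so the two random
  vectors are compared almost everywhere.\<close>

lemma distr_brownian_bridge_incs:
  assumes "standard_brownian_bridge M b X" and n: "n > 0"
  shows "distr M (seq_space n) (path_incs n \<circ> path01 X) = distr (incs n (1 / n)) (seq_space n) (bridge_incs n b)"
proof -
  obtain N :: "(real \<Rightarrow> real) measure" and B where bm: "standard_brownian_motion N B"
    and law: "equal_in_law path_space01 M (path01 X) N (path01 (\<lambda>t \<omega>. B t \<omega> - t * B 1 \<omega> + b * t))"
    using assms by (auto simp: standard_brownian_bridge_def)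
  let ?Y = "\<lambda>t \<omega>. B t \<omega> - t * B 1 \<omega> + b * t"
  let ?D = "\<lambda>\<omega>. \<lambda>i\<in>{..<n}. B (Suc i / n) \<omega> - B (i / n) \<omega>"
  have [measurable]: "path01 X \<in> measurable M path_space01" "path01 ?Y \<in> measurable N path_space01"
    and eq: "distr M path_space01 (path01 X) = distr N path_space01 (path01 ?Y)"
    using law by (auto simp: equal_in_law_def)
  have [measurable]: "B t \<in> borel_measurable N" if "t \<ge> 0" for t
    using bm that by (simp add: standard_brownian_motion_def)
  have [measurable]: "?D \<in> measurable N (seq_space n)"
    by measurable
  have [measurable]: "bridge_incs n b \<in> measurable (seq_space n) (seq_space n)"
    using measurable_Pair2[OF measurable_bridge_incs, of b n] by simp
  have "distr M (seq_space n) (path_incs n \<circ> path01 X) = distr (distr M path_space01 (path01 X)) (seq_space n) (path_incs n)"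
    by (rule distr_distr[symmetric]) measurable
  also have "\<dots> = distr N (seq_space n) (path_incs n \<circ> path01 ?Y)"
    unfolding eq by (rule distr_distr) measurable
  also have "\<dots> = distr N (seq_space n) (bridge_incs n b \<circ> ?D)"
  proof (rule distr_cong_AE)
    have "AE \<omega> in N. B 0 \<omega> = 0"
      using bm by (simp add: standard_brownian_motion_def)
    then show "AE \<omega> in N. (path_incs n \<circ> path01 ?Y) \<omega> = (bridge_incs n b \<circ> ?D) \<omega>"
    proof eventually_elim
      case (elim \<omega>)
      have "(\<Sum>j<n. B (Suc j / n) \<omega> - B (j / n) \<omega>) = B 1 \<omega>"
        using n elim sum_lessThan_telescope[of "\<lambda>j. B (j / n) \<omega>" n] by simp
      then have "(\<Sum>j<n. ?D \<omega> j) = B 1 \<omega>"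
        by simp
      then show ?case
        using n by (auto simp: path_incs_path01 bridge_incs_def fun_eq_iff restrict_def field_simps)
    qed
  qed (auto intro: measurable_comp)
  also have "\<dots> = distr (distr N (seq_space n) ?D) (seq_space n) (bridge_incs n b)"
    by (rule distr_distr[symmetric]) measurable
  also have "\<dots> = distr (incs n (1 / n)) (seq_space n) (bridge_incs n b)"
    unfolding distr_brownian_motion_incs[OF bm n] ..
  finally show ?thesis .
qed

section \<open>The difference of two bridges on a grid\<close>

definition bridge_path :: "(real \<Rightarrow> 'a \<Rightarrow> real) \<Rightarrow> (real \<Rightarrow> 'a \<Rightarrow> real) \<Rightarrow> 'a \<Rightarrow> real \<Rightarrow> real" where
  "bridge_path X1 X2 \<omega> t = (X1 t \<omega> - X1 0 \<omega>) + (X2 1 \<omega> - X2 t \<omega>)"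

text \<open>The \<open>2 / n\<close> is the variance that the difference of two independent bridges
  has per mesh interval before pinning; each factor is then \<open>1 - exp (- n * u * w)\<close> for
  positive distances \<open>u\<close> and \<open>w\<close>.\<close>

definition grid_surv :: "nat \<Rightarrow> real \<Rightarrow> (real \<Rightarrow> real) \<Rightarrow> real" where
  "grid_surv n x p = (\<Prod>i<n. surv (2 / n) (x - p (i / n)) (x - p (Suc i / n)))"

text \<open>Rewrites the product through increments, whose joint law is known. The path starts at
  \<open>X2 1 - X2 0\<close> and not at 0, so the level is lowered by the sum of the increments of
  \<open>X2\<close>, for the moment a random quantity.\<close>

lemma grid_surv_bridge_path:
  assumes n: "n > 0"
  shows "grid_surv n x (bridge_path X1 X2 \<omega>)
    = surv_walk n (2 / n) (x - (\<Sum>i<n. path_incs n (path01 X2 \<omega>) i))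
        (\<lambda>i\<in>{..<n}. path_incs n (path01 X1 \<omega>) i - path_incs n (path01 X2 \<omega>) i)"
proof -
  have tele: "(\<Sum>i<m. path_incs n (path01 X \<omega>) i) = X (m / n) \<omega> - X 0 \<omega>" if "m \<le> n" for X and m :: nat
  proof -
    have "(\<Sum>i<m. path_incs n (path01 X \<omega>) i) = (\<Sum>i<m. X (Suc i / n) \<omega> - X (i / n) \<omega>)"
      using that by (intro sum.cong) (auto simp: path_incs_path01)
    then show ?thesis
      using sum_lessThan_telescope[of "\<lambda>j. X (j / n) \<omega>" m] by simp
  qed
  have grid: "(x - (\<Sum>i<n. path_incs n (path01 X2 \<omega>) i))
      - (\<Sum>j<m. (\<lambda>i\<in>{..<n}. path_incs n (path01 X1 \<omega>) i - path_incs n (path01 X2 \<omega>) i) j)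
    = x - bridge_path X1 X2 \<omega> (m / n)" if "m \<le> n" for m
  proof -
    have "(\<Sum>j<m. (\<lambda>i\<in>{..<n}. path_incs n (path01 X1 \<omega>) i - path_incs n (path01 X2 \<omega>) i) j)
        = (\<Sum>j<m. path_incs n (path01 X1 \<omega>) j - path_incs n (path01 X2 \<omega>) j)"
      using that by (intro sum.cong) auto
    then show ?thesis
      using that n by (simp add: sum_subtractf tele bridge_path_def)
  qed
  show ?thesis
    unfolding grid_surv_def surv_walk_def
  proof (rule prod.cong[OF refl])
    fix i assume "i \<in> {..<n}"
    then have "i \<le> n" "Suc i \<le> n"
      by auto
    then show "surv (2 / n) (x - bridge_path X1 X2 \<omega> (i / n)) (x - bridge_path X1 X2 \<omega> (Suc i / n))
      = surv (2 / n)
          ((x - (\<Sum>i<n. path_incs n (path01 X2 \<omega>) i))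
            - (\<Sum>j<i. (\<lambda>i\<in>{..<n}. path_incs n (path01 X1 \<omega>) i - path_incs n (path01 X2 \<omega>) i) j))
          ((x - (\<Sum>i<n. path_incs n (path01 X2 \<omega>) i))
            - (\<Sum>j<Suc i. (\<lambda>i\<in>{..<n}. path_incs n (path01 X1 \<omega>) i - path_incs n (path01 X2 \<omega>) i) j))"
      by (simp only: grid)
  qed
qed

text \<open>The value is the same for every \<open>n\<close>, which is what makes the passage to the
  limit possible. The condition \<open>x > b2\<close> says that the path starts strictly below the
  level, as the formula for pinned walks requires.\<close>

lemma nn_integral_grid_surv:
  assumes X1: "standard_brownian_bridge M b1 X1" and X2: "standard_brownian_bridge M b2 X2"
    and indep: "prob_space.indep_var M path_space01 (path01 X1) path_space01 (path01 X2)"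
    and n: "n > 0" and x: "x > b2"
  shows "(\<integral>\<^sup>+\<omega>. grid_surv n x (bridge_path X1 X2 \<omega>) \<partial>M) = surv 2 (x - b2) (x - b1)"
proof -
  interpret prob_space M
    using X1 by (simp add: standard_brownian_bridge_def)
  let ?v = "1 / n :: real"
  have v: "?v > 0" using n by simp
  interpret I: prob_space "incs n ?v" by (rule prob_space_incs) fact
  have br [measurable]: "bridge_incs n b \<in> measurable (seq_space n) (seq_space n)" for b
    using measurable_Pair2[OF measurable_bridge_incs, of b n] by simp
  interpret J: prob_space "distr (incs n ?v) (seq_space n) (bridge_incs n b2)"
    by (rule I.prob_space_distr) measurable
  let ?D = "\<lambda>X. path_incs n \<circ> path01 X"
  define f where "f d1 d2 = surv_walk n (2 / n) (x - (\<Sum>i<n. d2 i)) (\<lambda>i\<in>{..<n}. d1 i - d2 i)" for d1 d2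
  have [measurable]: "(\<lambda>z. fst z i) \<in> borel_measurable (seq_space n \<Otimes>\<^sub>M seq_space n)"
     "(\<lambda>z. snd z i) \<in> borel_measurable (seq_space n \<Otimes>\<^sub>M seq_space n)" if "i < n" for i
    using measurable_seq_space_component[OF that measurable_fst] measurable_seq_space_component[OF that measurable_snd] .
  have [measurable]: "case_prod f \<in> borel_measurable (seq_space n \<Otimes>\<^sub>M seq_space n)"
  proof -
    have s2: "(\<lambda>z. \<Sum>i<n. snd z i) \<in> borel_measurable (seq_space n \<Otimes>\<^sub>M seq_space n)"
      by (rule measurable_seq_space_sum[OF order_refl measurable_snd])
    have "(\<lambda>z. \<lambda>i\<in>{..<n}. fst z i - snd z i) \<in> measurable (seq_space n \<Otimes>\<^sub>M seq_space n) (seq_space n)"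
      by measurable
    note sums = measurable_seq_space_sum[OF _ this]
    show ?thesis
      unfolding f_def split_beta surv_walk_def
    proof (rule borel_measurable_prod)
      fix i assume "i \<in> {..<n}"
      then have "i \<le> n" "Suc i \<le> n"
        by auto
      note [measurable] = s2 sums[OF this(1)] sums[OF this(2)]
      show "(\<lambda>z. surv (2 / n)
          (x - (\<Sum>i<n. snd z i) - (\<Sum>j<i. (\<lambda>i\<in>{..<n}. fst z i - snd z i) j))
          (x - (\<Sum>i<n. snd z i) - (\<Sum>j<Suc i. (\<lambda>i\<in>{..<n}. fst z i - snd z i) j)))
        \<in> borel_measurable (seq_space n \<Otimes>\<^sub>M seq_space n)"
        by measurable
    qed
  qed
  have "indep_var (seq_space n) (?D X1) (seq_space n) (?D X2)"
    by (rule indep_var_compose[OF indep]) measurable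
  then have rv: "random_variable (seq_space n) (?D X1)" "random_variable (seq_space n) (?D X2)"
    and joint: "distr M (seq_space n \<Otimes>\<^sub>M seq_space n) (\<lambda>\<omega>. (?D X1 \<omega>, ?D X2 \<omega>))
      = distr M (seq_space n) (?D X1) \<Otimes>\<^sub>M distr M (seq_space n) (?D X2)"
    by (auto simp: indep_var_distribution_eq)
  note [measurable] = rv
  have "(\<integral>\<^sup>+\<omega>. grid_surv n x (bridge_path X1 X2 \<omega>) \<partial>M) = (\<integral>\<^sup>+\<omega>. case_prod f (?D X1 \<omega>, ?D X2 \<omega>) \<partial>M)"
    by (simp add: f_def grid_surv_bridge_path[OF n])
  also have "\<dots> = (\<integral>\<^sup>+z. case_prod f z \<partial>distr M (seq_space n \<Otimes>\<^sub>M seq_space n) (\<lambda>\<omega>. (?D X1 \<omega>, ?D X2 \<omega>)))"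
    by (rule nn_integral_distr[symmetric]) measurable
  also have "\<dots> = (\<integral>\<^sup>+d1. \<integral>\<^sup>+d2. f d1 d2 \<partial>distr (incs n ?v) (seq_space n) (bridge_incs n b2)
      \<partial>distr (incs n ?v) (seq_space n) (bridge_incs n b1))"
    unfolding joint distr_brownian_bridge_incs[OF X1 n] distr_brownian_bridge_incs[OF X2 n]
    by (subst J.nn_integral_fst[symmetric]) auto
  also have "\<dots> = (\<integral>\<^sup>+d1. \<integral>\<^sup>+d2. f (bridge_incs n b1 d1) (bridge_incs n b2 d2) \<partial>incs n ?v \<partial>incs n ?v)"
  proof -
    have "(\<integral>\<^sup>+d2. f d1 d2 \<partial>distr (incs n ?v) (seq_space n) (bridge_incs n b2))
        = (\<integral>\<^sup>+d2. f d1 (bridge_incs n b2 d2) \<partial>incs n ?v)" if [measurable]: "d1 \<in> space (seq_space n)" for d1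
      by (rule nn_integral_distr) measurable
    then have "(\<integral>\<^sup>+d1. \<integral>\<^sup>+d2. f d1 d2 \<partial>distr (incs n ?v) (seq_space n) (bridge_incs n b2)
          \<partial>distr (incs n ?v) (seq_space n) (bridge_incs n b1))
        = (\<integral>\<^sup>+d1. \<integral>\<^sup>+d2. f d1 (bridge_incs n b2 d2) \<partial>incs n ?v
          \<partial>distr (incs n ?v) (seq_space n) (bridge_incs n b1))"
      by (intro nn_integral_cong) simp
    also have "\<dots> = (\<integral>\<^sup>+d1. \<integral>\<^sup>+d2. f (bridge_incs n b1 d1) (bridge_incs n b2 d2) \<partial>incs n ?v \<partial>incs n ?v)"
      by (rule nn_integral_distr) measurable
    finally show ?thesis .
  qed
  also have "\<dots> = (\<integral>\<^sup>+d1. \<integral>\<^sup>+d2. surv_walk n (2 / n) (x - b2)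
      (bridge_incs n (b1 - b2) (\<lambda>i\<in>{..<n}. d1 i - d2 i)) \<partial>incs n ?v \<partial>incs n ?v)"
  \<comment> \<open>Recentred increments of \<open>X2\<close> sum to exactly \<open>b2\<close>, so
    the level becomes deterministic; recentring is affine, so the difference of two pinned walks is
    the difference walk pinned at \<open>b1 - b2\<close>.\<close>
  proof -
    have "(\<Sum>i<n. bridge_incs n b2 d i) = b2" for d
      using n by (simp add: bridge_incs_def sum.distrib)
    moreover have "(\<lambda>i\<in>{..<n}. bridge_incs n b1 d1 i - bridge_incs n b2 d2 i)
        = bridge_incs n (b1 - b2) (\<lambda>i\<in>{..<n}. d1 i - d2 i)" for d1 d2
      using n by (auto simp: bridge_incs_def fun_eq_iff sum_subtractf field_simps)
    ultimately show ?thesis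
      by (simp add: f_def)
  qed
  also have "\<dots> = (\<integral>\<^sup>+d. surv_walk n (2 / n) (x - b2) (bridge_incs n (b1 - b2) d) \<partial>incs n (?v + ?v))"
    by (rule nn_integral_incs_diff[OF _ v v]) measurable
  \<comment> \<open>The total variance is \<open>n * (2 / n) = 2\<close>, and the final distance is
    \<open>x - b2 - (b1 - b2) = x - b1\<close>.\<close>
  also have "\<dots> = surv 2 (x - b2) (x - b1)"
    using nn_integral_surv_walk_bridge[of "x - b2" "2 / n" n "b1 - b2"] n x by simp
  finally show ?thesis .
qed

section \<open>Limits of the grid product along a fixed path\<close>

lemma grid_surv_le_1: "n > 0 \<Longrightarrow> grid_surv n x p \<le> 1"
  unfolding grid_surv_def by (intro prod_le_1 conjI surv_nonneg surv_le_1) simp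

text \<open>A uniform gap \<open>\<delta>\<close> makes each of the \<open>n\<close> factors at
  least \<open>1 - exp (- (\<delta>^2 * n))\<close>; by Bernoulli's inequality the product loses at
  most \<open>n\<close> times an exponentially small term.\<close>

lemma grid_surv_tendsto_1:
  assumes \<delta>: "\<delta> > 0" and p: "\<And>t. t \<in> {0..1} \<Longrightarrow> p t \<le> x - \<delta>"
  shows "(\<lambda>n. grid_surv n x p) \<longlonglongrightarrow> 1"
proof (rule tendsto_sandwich)
  show "(\<lambda>n. 1 - real n * exp (- (\<delta>\<^sup>2 * real n))) \<longlonglongrightarrow> 1"
    using \<delta> by real_asymp
  show "\<forall>\<^sub>F n in sequentially. 1 - real n * exp (- (\<delta>\<^sup>2 * real n)) \<le> grid_surv n x p"
    using eventually_gt_at_top[of 0]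
  proof eventually_elim
    case (elim n)
    have grid: "\<delta> \<le> x - p (i / n)" if "i \<le> n" for i :: nat
      using p[of "i / n"] that elim by (simp add: divide_le_eq_1)
    have "1 - real n * exp (- (\<delta>\<^sup>2 * n)) \<le> (1 - exp (- (\<delta>\<^sup>2 * n))) ^ n"
      using Bernoulli_inequality[of "- exp (- (\<delta>\<^sup>2 * n))" n] by simp
    also have "\<dots> = (\<Prod>i<n. surv (2 / n) \<delta> \<delta>)"
      using \<delta> by (simp add: surv_def power2_eq_square mult.assoc)
    also have "\<dots> \<le> grid_surv n x p"
      unfolding grid_surv_def using elim
      by (intro prod_mono conjI surv_nonneg surv_mono grid) auto
    finally show ?case .
  qed
  show "\<forall>\<^sub>F n in sequentially. grid_surv n x p \<le> 1"
    using eventually_gt_at_top[of 0] by eventually_elim (rule grid_surv_le_1)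
qed simp_all

text \<open>By continuity a fine grid has a point near \<open>t\<close> at which the path exceeds
  \<open>x\<close>, and a single nonpositive distance makes a factor exactly 0.\<close>

lemma grid_surv_eventually_0:
  assumes cont: "continuous_on {0..1} p" and t: "t \<in> {0..1}" "p t > x"
  shows "\<forall>\<^sub>F n in sequentially. grid_surv n x p = 0"
proof -
  have "p t - x > 0"
    using t by simp
  with cont t obtain d where d: "d > 0" and near: "\<And>s. s \<in> {0..1} \<Longrightarrow> dist s t < d \<Longrightarrow> dist (p s) (p t) < p t - x"
    unfolding continuous_on_iff by blast
  have "\<forall>\<^sub>F n in sequentially. 1 / real n < d"
    using d by real_asymp
  with eventually_gt_at_top[of 0] show ?thesis
  proof eventually_elim
    case (elim n)
    \<comment> \<open>Index of the last grid point not to the right of \<open>t\<close>; it lies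
      within \<open>1 / n\<close> of \<open>t\<close>.\<close>
    define k where "k = nat \<lfloor>t * n\<rfloor>"
    have k: "real k \<le> t * n" "t * n < real k + 1"
      using t elim by (auto simp: k_def)
    have "t * n \<le> n"
      using t by (simp add: mult_left_le_one_le)
    with k have "k \<le> n" by linarith
    have "k / n \<le> t" "t < (real k + 1) / n"
      using k elim by (simp_all add: pos_divide_le_eq pos_less_divide_eq)
    then have "k / n \<le> t" "t - k / n < 1 / n"
      by (simp_all add: add_divide_distrib)
    then have "dist (k / n) t < d"
      using elim by (simp add: dist_real_def)
    then have pk: "p (k / n) > x"
      using near[of "k / n"] \<open>k \<le> n\<close> elim by (auto simp: dist_real_def divide_le_eq_1)
    show ?case
    proof (cases "k < n")
      case True
      with pk show ?thesis
        unfolding grid_surv_def by (intro prod_zero) (auto simp: surv_def intro!: bexI[of _ k])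
    next
      \<comment> \<open>The endpoint \<open>k = n\<close> begins no mesh interval, so the vanishing
        factor is the one with index \<open>n - 1\<close>, of which it is the right end.\<close>
      case False
      with \<open>k \<le> n\<close> elim have "k = Suc (n - 1)" "n - 1 < n" by auto
      with pk show ?thesis
        unfolding grid_surv_def by (intro prod_zero) (auto simp: surv_def intro!: bexI[of _ "n - 1"] simp del: of_nat_Suc)
    qed
  qed
qed

section \<open>The maximum of the bridge path\<close>

lemma V_bb_eq: "V_bb X1 X2 \<omega> = (SUP t\<in>{0..1}. bridge_path X1 X2 \<omega> t)"
  by (simp add: V_bb_def bridge_path_def)

text \<open>Density of the grid points, obtained from \<open>grid_surv_eventually_0\<close>: at the
  level halfway between \<open>x\<close> and a larger value \<open>p t\<close> the product would
  vanish for some \<open>n\<close>, although all its factors are positive.\<close>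

lemma bounded_on_grid_imp_bounded:
  fixes p :: "real \<Rightarrow> real"
  assumes cont: "continuous_on {0..1} p" and t: "t \<in> {0..1}"
    and grid: "\<And>n i. n > 0 \<Longrightarrow> i \<le> n \<Longrightarrow> p (real i / real n) \<le> x"
  shows "p t \<le> x"
proof (rule ccontr)
  assume "\<not> p t \<le> x"
  then have lt: "x < (x + p t) / 2" "(x + p t) / 2 < p t"
    by auto
  have "\<forall>\<^sub>F n in sequentially. grid_surv n ((x + p t) / 2) p = 0 \<and> n > 0"
    by (intro eventually_conj grid_surv_eventually_0[OF cont t lt(2)] eventually_gt_at_top)
  then obtain n where n: "grid_surv n ((x + p t) / 2) p = 0" "n > 0"
    by (auto dest: eventually_happens)
  have "grid_surv n ((x + p t) / 2) p > 0"
    unfolding grid_surv_def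
  proof (rule prod_pos, rule surv_pos)
    fix i assume "i \<in> {..<n}"
    then have "i \<le> n" "Suc i \<le> n" by auto
    then show "0 < (x + p t) / 2 - p (i / n)" "0 < (x + p t) / 2 - p (Suc i / n)"
      using grid[OF n(2)] lt(1) by (meson diff_gt_0_iff_gt le_less_trans)+
  qed (use n in simp)
  with n show False by simp
qed

locale bridge_pair = prob_space M for M :: "'a measure" +
  fixes b1 b2 :: real and X1 X2 :: "real \<Rightarrow> 'a \<Rightarrow> real"
  assumes X1: "standard_brownian_bridge M b1 X1" and X2: "standard_brownian_bridge M b2 X2"
    and indep: "indep_var path_space01 (path01 X1) path_space01 (path01 X2)"
begin

abbreviation P :: "'a \<Rightarrow> real \<Rightarrow> real" where "P \<equiv> bridge_path X1 X2"

abbreviation V :: "'a \<Rightarrow> real" where "V \<equiv> V_bb X1 X2"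

lemma continuous_P: "\<omega> \<in> space M \<Longrightarrow> continuous_on {0..1} (P \<omega>)"
  using X1 X2 unfolding bridge_path_def standard_brownian_bridge_def
  by (intro continuous_intros) auto

lemma measurable_P [measurable]:
  assumes t: "0 \<le> t" "t \<le> 1"
  shows "(\<lambda>\<omega>. P \<omega> t) \<in> borel_measurable M"
proof -
  have meas: "X s \<in> borel_measurable M" if "standard_brownian_bridge M b X" "s \<in> {0..1}" for b X s
  proof -
    have "path01 X \<in> measurable M path_space01"
      using that(1) by (auto simp: standard_brownian_bridge_def equal_in_law_def)
    from measurable_compose[OF this measurable_component_singleton[OF that(2)]]
    show ?thesis
      using that(2) by (simp add: path01_def)
  qed
  show ?thesis
    unfolding bridge_path_def
    by (intro borel_measurable_add borel_measurable_diff meas[OF X1] meas[OF X2]) (use t in auto)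
qed

lemma measurable_grid_surv [measurable]: "(\<lambda>\<omega>. grid_surv n x (P \<omega>)) \<in> borel_measurable M"
  unfolding grid_surv_def
proof (rule borel_measurable_prod)
  fix i assume "i \<in> {..<n}"
  then have [measurable]: "(\<lambda>\<omega>. P \<omega> (i / n)) \<in> borel_measurable M" "(\<lambda>\<omega>. P \<omega> (Suc i / n)) \<in> borel_measurable M"
    by (auto intro!: measurable_P simp: divide_le_eq_1)
  show "(\<lambda>\<omega>. surv (2 / n) (x - P \<omega> (i / n)) (x - P \<omega> (Suc i / n))) \<in> borel_measurable M"
    by measurable
qed

lemma P_le_V:
  assumes "\<omega> \<in> space M" "t \<in> {0..1}" shows "P \<omega> t \<le> V \<omega>"
proof -
  have "compact (P \<omega> ` {0..1})"
    using continuous_P[OF assms(1)] by (intro compact_continuous_image) auto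
  then have "bdd_above (P \<omega> ` {0..1})"
    by (simp add: bounded_imp_bdd_above compact_imp_bounded)
  then show ?thesis
    unfolding V_bb_eq using assms(2) by (rule cSUP_upper[rotated])
qed

lemma V_le_iff:
  assumes "\<omega> \<in> space M" shows "V \<omega> \<le> x \<longleftrightarrow> (\<forall>t\<in>{0..1}. P \<omega> t \<le> x)"
proof
  assume "V \<omega> \<le> x"
  then show "\<forall>t\<in>{0..1}. P \<omega> t \<le> x"
    using P_le_V[OF assms] order_trans by blast
next
  assume "\<forall>t\<in>{0..1}. P \<omega> t \<le> x"
  then show "V \<omega> \<le> x"
    unfolding V_bb_eq by (intro cSUP_least) auto
qed

text \<open>Replaces the supremum over an interval by countably many conditions, from which
  measurability of \<open>V\<close> follows.\<close>

lemma V_le_iff_grid: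
  assumes "\<omega> \<in> space M"
  shows "V \<omega> \<le> x \<longleftrightarrow> (\<forall>n. \<forall>i\<in>{..Suc n}. P \<omega> (real i / real (Suc n)) \<le> x)"
proof
  assume "V \<omega> \<le> x"
  moreover have "real i / real (Suc n) \<in> {0..1}" if "i \<in> {..Suc n}" for i n
    using that by (simp add: divide_le_eq_1 del: of_nat_Suc)
  ultimately show "\<forall>n. \<forall>i\<in>{..Suc n}. P \<omega> (real i / real (Suc n)) \<le> x"
    using V_le_iff[OF assms] by blast
next
  assume grid: "\<forall>n. \<forall>i\<in>{..Suc n}. P \<omega> (real i / real (Suc n)) \<le> x"
  have "P \<omega> (real i / real n) \<le> x" if "n > 0" "i \<le> n" for n i
    using grid[rule_format, of i "n - 1"] that by simp
  then have "P \<omega> t \<le> x" if "t \<in> {0..1}" for t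
    by (rule bounded_on_grid_imp_bounded[OF continuous_P[OF assms] that])
  then show "V \<omega> \<le> x"
    unfolding V_le_iff[OF assms] by blast
qed

lemma measurable_V [measurable]: "V \<in> borel_measurable M"
  unfolding borel_measurable_iff_le
proof
  fix x
  have "(\<lambda>\<omega>. P \<omega> (real i / real (Suc n))) \<in> borel_measurable M" if "i \<in> {..Suc n}" for n i
    using that by (intro measurable_P) (simp_all add: divide_le_eq_1 del: of_nat_Suc)
  then have "{\<omega> \<in> space M. \<forall>n. \<forall>i\<in>{..Suc n}. P \<omega> (real i / real (Suc n)) \<le> x} \<in> sets M"
    by (intro sets.sets_Collect_countable_All sets.sets_Collect_finite_All' borel_measurable_le) auto
  then show "{\<omega> \<in> space M. V \<omega> \<le> x} \<in> sets M"
    using V_le_iff_grid by (simp cong: conj_cong)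
qed

lemma nn_integral_grid_surv_P:
  "x > b2 \<Longrightarrow> (\<integral>\<^sup>+\<omega>. grid_surv (Suc n) x (P \<omega>) \<partial>M) = surv 2 (x - b2) (x - b1)"
  using nn_integral_grid_surv[OF X1 X2 indep] by simp

text \<open>The strict inequality supplies the gap \<open>x - V \<omega>\<close> that convergence of
  the products to 1 needs. On the event \<open>V = x\<close> no limit is claimed, here or in the
  bound from the other side.\<close>

lemma prob_V_less_le:
  assumes x: "x > b2" shows "prob {\<omega> \<in> space M. V \<omega> < x} \<le> surv 2 (x - b2) (x - b1)"
proof -
  have "emeasure M {\<omega> \<in> space M. V \<omega> < x} = (\<integral>\<^sup>+\<omega>. indicator {\<omega> \<in> space M. V \<omega> < x} \<omega> \<partial>M)"
    by (rule nn_integral_indicator[symmetric]) measurable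
  also have "\<dots> \<le> (\<integral>\<^sup>+\<omega>. liminf (\<lambda>n. ennreal (grid_surv (Suc n) x (P \<omega>))) \<partial>M)"
  proof (rule nn_integral_mono)
    fix \<omega> assume \<omega>: "\<omega> \<in> space M"
    show "indicator {\<omega> \<in> space M. V \<omega> < x} \<omega> \<le> liminf (\<lambda>n. ennreal (grid_surv (Suc n) x (P \<omega>)))"
    proof (cases "V \<omega> < x")
      case True
      have "(\<lambda>n. grid_surv n x (P \<omega>)) \<longlonglongrightarrow> 1"
        by (rule grid_surv_tendsto_1[of "x - V \<omega>"]) (use True P_le_V[OF \<omega>] in auto)
      then have "(\<lambda>n. ennreal (grid_surv (Suc n) x (P \<omega>))) \<longlonglongrightarrow> ennreal 1"
        by (intro tendsto_ennrealI LIMSEQ_Suc)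
      then show ?thesis
        using lim_imp_Liminf[OF sequentially_bot] by (fastforce simp: indicator_def)
    qed simp
  qed
  also have "\<dots> \<le> liminf (\<lambda>n. \<integral>\<^sup>+\<omega>. ennreal (grid_surv (Suc n) x (P \<omega>)) \<partial>M)"
    by (rule nn_integral_liminf) measurable
  also have "\<dots> = surv 2 (x - b2) (x - b1)"
    using x by (simp add: nn_integral_grid_surv_P Liminf_const)
  finally show ?thesis
    by (simp add: emeasure_eq_measure)
qed

lemma prob_V_greater_le:
  assumes x: "x > b2" shows "prob {\<omega> \<in> space M. V \<omega> > x} \<le> 1 - surv 2 (x - b2) (x - b1)"
proof -
  have "emeasure M {\<omega> \<in> space M. V \<omega> > x} = (\<integral>\<^sup>+\<omega>. indicator {\<omega> \<in> space M. V \<omega> > x} \<omega> \<partial>M)"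
    by (rule nn_integral_indicator[symmetric]) measurable
  also have "\<dots> \<le> (\<integral>\<^sup>+\<omega>. liminf (\<lambda>n. 1 - ennreal (grid_surv (Suc n) x (P \<omega>))) \<partial>M)"
  proof (rule nn_integral_mono)
    fix \<omega> assume \<omega>: "\<omega> \<in> space M"
    show "indicator {\<omega> \<in> space M. V \<omega> > x} \<omega> \<le> liminf (\<lambda>n. 1 - ennreal (grid_surv (Suc n) x (P \<omega>)))"
    proof (cases "V \<omega> > x")
      case True
      then obtain t where t: "t \<in> {0..1}" "P \<omega> t > x"
        using V_le_iff[OF \<omega>, of x] by force
      have "\<forall>\<^sub>F n in sequentially. grid_surv (Suc n) x (P \<omega>) = 0"
        using grid_surv_eventually_0[OF continuous_P[OF \<omega>] t]
        by (rule eventually_sequentially_Suc[THEN iffD2])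
      then have "(\<lambda>n. 1 - ennreal (grid_surv (Suc n) x (P \<omega>))) \<longlonglongrightarrow> 1"
        by (intro tendsto_eventually) (auto elim!: eventually_mono)
      then show ?thesis
        using lim_imp_Liminf[OF sequentially_bot] by (fastforce simp: indicator_def)
    qed simp
  qed
  also have "\<dots> \<le> liminf (\<lambda>n. \<integral>\<^sup>+\<omega>. 1 - ennreal (grid_surv (Suc n) x (P \<omega>)) \<partial>M)"
    by (rule nn_integral_liminf) measurable
  also have "(\<lambda>n. \<integral>\<^sup>+\<omega>. 1 - ennreal (grid_surv (Suc n) x (P \<omega>)) \<partial>M) = (\<lambda>n. ennreal (1 - surv 2 (x - b2) (x - b1)))"
  proof
    fix n
    \<comment> \<open>Subtraction of extended nonnegative reals is truncated at 0, so linearity of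
      the integral relies on the products being at most 1.\<close>
    have "(\<integral>\<^sup>+\<omega>. 1 - ennreal (grid_surv (Suc n) x (P \<omega>)) \<partial>M)
        = (\<integral>\<^sup>+\<omega>. 1 \<partial>M) - (\<integral>\<^sup>+\<omega>. grid_surv (Suc n) x (P \<omega>) \<partial>M)"
      by (rule nn_integral_diff) (auto simp: nn_integral_grid_surv_P[OF x] ennreal_1[symmetric] grid_surv_le_1 intro!: ennreal_leI simp del: ennreal_1)
    also have "\<dots> = ennreal 1 - ennreal (surv 2 (x - b2) (x - b1))"
      by (simp add: nn_integral_grid_surv_P[OF x] emeasure_space_1)
    also have "\<dots> = ennreal (1 - surv 2 (x - b2) (x - b1))"
      by (rule ennreal_minus) simp
    finally show "(\<integral>\<^sup>+\<omega>. 1 - ennreal (grid_surv (Suc n) x (P \<omega>)) \<partial>M) = ennreal (1 - surv 2 (x - b2) (x - b1))" .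
  qed
  finally show ?thesis
    by (simp add: Liminf_const emeasure_eq_measure surv_le_1)
qed

text \<open>The two Fatou bounds leave out the event \<open>V = x\<close>. Passing to the complement
  gives the lower bound directly; the upper bound comes from slightly higher levels and the
  continuity of the limit function, so an atom is excluded without further work.\<close>

lemma prob_V_le: "prob {\<omega> \<in> space M. V \<omega> \<le> x} = surv 2 (x - b2) (x - b1)"
proof (rule antisym)
  define G where "G x = surv 2 (x - b2) (x - b1)" for x
  have G_eq: "G x = 1 - exp (- (max 0 (x - b2) * max 0 (x - b1)))" for x
    by (auto simp: G_def surv_def max_def)
  \<comment> \<open>The strict bound is available only above \<open>b2\<close>. For \<open>x\<close>
    at or below \<open>b2\<close> the levels decrease to \<open>b2\<close>, where \<open>G\<close>
    is already 0 and so agrees with \<open>G x\<close>.\<close>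
  define x0 where "x0 = max x b2"
  have "(\<lambda>k. G (x0 + inverse (real (Suc k)))) \<longlonglongrightarrow> G (x0 + 0)"
    unfolding G_eq by (intro tendsto_intros LIMSEQ_inverse_real_of_nat)
  moreover have "prob {\<omega> \<in> space M. V \<omega> \<le> x} \<le> G (x0 + inverse (real (Suc k)))" for k
  proof -
    have "0 < inverse (real (Suc k))" "x \<le> x0" "b2 \<le> x0"
      by (simp_all add: x0_def)
    then have gt: "x < x0 + inverse (real (Suc k))" "b2 < x0 + inverse (real (Suc k))"
      by linarith+
    have "prob {\<omega> \<in> space M. V \<omega> \<le> x} \<le> prob {\<omega> \<in> space M. V \<omega> < x0 + inverse (real (Suc k))}"
      using gt(1) by (intro finite_measure_mono) (auto simp del: of_nat_Suc)
    also have "\<dots> \<le> G (x0 + inverse (real (Suc k)))"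
      unfolding G_def by (rule prob_V_less_le) (rule gt(2))
    finally show ?thesis .
  qed
  ultimately have "prob {\<omega> \<in> space M. V \<omega> \<le> x} \<le> G (x0 + 0)"
    by (intro LIMSEQ_le_const) auto
  also have "G (x0 + 0) = G x"
    by (auto simp: G_def surv_def x0_def max_def)
  finally show "prob {\<omega> \<in> space M. V \<omega> \<le> x} \<le> surv 2 (x - b2) (x - b1)"
    by (simp add: G_def)
next
  show "surv 2 (x - b2) (x - b1) \<le> prob {\<omega> \<in> space M. V \<omega> \<le> x}"
  proof (cases "x > b2")
    case True
    have "prob {\<omega> \<in> space M. V \<omega> > x} = 1 - prob {\<omega> \<in> space M. V \<omega> \<le> x}"
      by (subst prob_neg[symmetric]) (auto simp: not_le)
    with prob_V_greater_le[OF True] show ?thesis by simp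
  qed (simp add: surv_def)
qed

end

section \<open>The largest eigenvalue\<close>

lemma det_2_by_2:
  fixes A :: "'a :: comm_ring_1 mat"
  assumes A: "A \<in> carrier_mat 2 2"
  shows "det A = A $$ (0, 0) * A $$ (1, 1) - A $$ (0, 1) * A $$ (1, 0)"
proof -
  have cof: "cofactor A 0 j = (- 1) ^ j * mat_delete A 0 j $$ (0, 0)" if "j < 2" for j
    using that A by (simp add: cofactor_def) (intro arg_cong2[where f="(*)"] refl det_single, auto)
  have minors: "mat_delete A 0 0 $$ (0, 0) = A $$ (1, 1)" "mat_delete A 0 1 $$ (0, 0) = A $$ (1, 0)"
    using A by (simp_all add: mat_delete_def)
  have "det A = (\<Sum>j<2. A $$ (0, j) * cofactor A 0 j)"
    by (rule laplace_expansion_row[OF A]) simp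
  also have "{..<2} = {0, 1 :: nat}"
    by auto
  finally show ?thesis
    using minors by (simp add: cof)
qed

lemma largest_eigenvalue_M_bb:
  "largest_eigenvalue (M_bb b1 b2 y z) = (b1 + b2 + sqrt ((b1 - b2)\<^sup>2 + 4 * (y\<^sup>2 + z\<^sup>2))) / 2"
proof -
  let ?A = "M_bb b1 b2 y z" and ?s = "sqrt ((b1 - b2)\<^sup>2 + 4 * (y\<^sup>2 + z\<^sup>2))"
  have A: "?A \<in> carrier_mat 2 2"
    by (simp add: M_bb_def mat_of_rows_list_def numeral_2_eq_2)
  have s2: "?s\<^sup>2 = (b1 - b2)\<^sup>2 + 4 * (y\<^sup>2 + z\<^sup>2)"
    by simp
  have "eigenvalue ?A (complex_of_real x) \<longleftrightarrow> x = (b1 + b2 + ?s) / 2 \<or> x = (b1 + b2 - ?s) / 2" for x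
  proof -
    have "det (char_matrix ?A (complex_of_real x)) = complex_of_real ((b1 - x) * (b2 - x) - (y\<^sup>2 + z\<^sup>2))"
      using A by (subst det_2_by_2)
        (auto simp: char_matrix_def M_bb_def mat_of_rows_list_def algebra_simps power2_eq_square)
    then have "eigenvalue ?A (complex_of_real x) \<longleftrightarrow> (b1 - x) * (b2 - x) - (y\<^sup>2 + z\<^sup>2) = 0"
      unfolding eigenvalue_det[OF A] by (simp only: of_real_eq_0_iff)
    \<comment> \<open>Completing the square in the characteristic polynomial: \<open>?s\<close>
      squared is its discriminant, trace squared minus four times the determinant.\<close>
    also have "\<dots> \<longleftrightarrow> (2 * x - (b1 + b2))\<^sup>2 = ?s\<^sup>2"
      unfolding s2 by (auto simp: power2_eq_square algebra_simps)
    also have "\<dots> \<longleftrightarrow> x = (b1 + b2 + ?s) / 2 \<or> x = (b1 + b2 - ?s) / 2"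
      unfolding power2_eq_iff by auto
    finally show ?thesis .
  qed
  then have "{x. eigenvalue ?A (complex_of_real x)} = {(b1 + b2 + ?s) / 2, (b1 + b2 - ?s) / 2}"
    by (simp only: insert_def Un_def mem_Collect_eq empty_iff simp_thms Collect_disj_eq[symmetric])
  moreover have "Max {(c + s) / 2, (c - s) / 2} = (c + s) / 2" if "0 \<le> s" for c s :: real
    using that by (simp add: max_def)
  ultimately show ?thesis
    by (simp add: largest_eigenvalue_def)
qed

text \<open>This is the criterion for \<open>x\<close> times the identity minus the matrix to be
  positive semidefinite: nonnegative diagonal and nonnegative determinant. It brings out the product
  that also appears in the law of the maximum.\<close>

lemma largest_eigenvalue_M_bb_le_iff:
  "largest_eigenvalue (M_bb b1 b2 y z) \<le> x \<longleftrightarrow> b1 \<le> x \<and> b2 \<le> x \<and> y\<^sup>2 + z\<^sup>2 \<le> (x - b2) * (x - b1)"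
proof -
  have "largest_eigenvalue (M_bb b1 b2 y z) \<le> x
    \<longleftrightarrow> sqrt ((b1 - b2)\<^sup>2 + 4 * (y\<^sup>2 + z\<^sup>2)) \<le> 2 * x - b1 - b2"
    by (auto simp: largest_eigenvalue_M_bb)
  also have "\<dots> \<longleftrightarrow> 0 \<le> 2 * x - b1 - b2 \<and> (b1 - b2)\<^sup>2 + 4 * (y\<^sup>2 + z\<^sup>2) \<le> (2 * x - b1 - b2)\<^sup>2"
    by (meson order.trans real_le_rsqrt real_sqrt_ge_zero real_sqrt_le_iff real_le_lsqrt sqrt_le_D sum_power2_ge_zero add_nonneg_nonneg zero_le_power2 mult_nonneg_nonneg zero_le_numeral)
  also have "\<dots> \<longleftrightarrow> 0 \<le> 2 * x - b1 - b2 \<and> y\<^sup>2 + z\<^sup>2 \<le> (x - b2) * (x - b1)"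
    by (auto simp: power2_eq_square algebra_simps)
  also have "\<dots> \<longleftrightarrow> b1 \<le> x \<and> b2 \<le> x \<and> y\<^sup>2 + z\<^sup>2 \<le> (x - b2) * (x - b1)"
  proof -
    \<comment> \<open>A nonnegative product excludes factors of strictly opposite signs, and their
      nonnegative sum excludes that both are negative.\<close>
    have "b1 \<le> x \<and> b2 \<le> x" if "0 \<le> 2 * x - b1 - b2" "y\<^sup>2 + z\<^sup>2 \<le> (x - b2) * (x - b1)"
    proof -
      have "0 \<le> (x - b2) * (x - b1)"
        using that(2) by (rule order_trans[rotated]) simp
      with that(1) show ?thesis
        by (auto simp: zero_le_mult_iff)
    qed
    then show ?thesis by auto
  qed
  finally show ?thesis .
qed

section \<open>Law of the squared modulus of the off-diagonal entry\<close>

lemma nn_integral_radial: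
  fixes k r :: real
  assumes k: "k > 0" and r: "r \<ge> 0"
  shows "(\<integral>\<^sup>+x. ennreal (\<bar>x\<bar> * exp (- (k * x\<^sup>2))) * indicator {x. r < k * x\<^sup>2} x \<partial>lborel) = ennreal (exp (- r)) * ennreal (1 / k)"
proof -
  let ?f = "\<lambda>x::real. ennreal (\<bar>x\<bar> * exp (- (k * x\<^sup>2)))"
  \<comment> \<open>The region is \<open>\<bar>x\<bar> > a\<close>. Since
    \<open>k * a^2 = r\<close>, the antiderivative at \<open>a\<close> contributes
    \<open>exp (- r)\<close> whatever \<open>k\<close> is, which separates \<open>r\<close> from
    \<open>k\<close> in the result.\<close>
  define a where "a = sqrt (r / k)"
  have a: "a \<ge> 0" "k * a\<^sup>2 = r"
    using k r by (auto simp: a_def)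
  have iff: "r < k * x\<^sup>2 \<longleftrightarrow> a < \<bar>x\<bar>" for x
  proof -
    have "r < k * x\<^sup>2 \<longleftrightarrow> a\<^sup>2 < x\<^sup>2"
      using k by (simp flip: a(2))
    then show ?thesis
      using a(1) by (metis abs_of_nonneg abs_le_square_iff not_le)
  qed
  have half: "(\<integral>\<^sup>+x. ?f x * indicator {a<..} x \<partial>lborel) = ennreal (exp (- r) / (2 * k))"
  proof -
    \<comment> \<open>Closing the ray changes the integrand only at the point \<open>a\<close>, and
      \<open>a >= 0\<close> removes the absolute value, so the fundamental theorem of calculus
      applies.\<close>
    have "(\<integral>\<^sup>+x. ?f x * indicator {a<..} x \<partial>lborel) = (\<integral>\<^sup>+x. ennreal (x * exp (- (k * x\<^sup>2))) * indicator {a..} x \<partial>lborel)"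
      using a(1) by (intro nn_integral_cong_AE eventually_mono[OF AE_lborel_singleton[of a]]) (auto simp: indicator_def)
    also have "\<dots> = ennreal (0 - (- exp (- (k * a\<^sup>2)) / (2 * k)))"
    proof (rule nn_integral_FTC_atLeast)
      show "((\<lambda>x. - exp (- (k * x\<^sup>2)) / (2 * k)) \<longlongrightarrow> 0) at_top"
        using k by real_asymp
      show "DERIV (\<lambda>x. - exp (- (k * x\<^sup>2)) / (2 * k)) x :> x * exp (- (k * x\<^sup>2))" for x
        using k by (auto intro!: derivative_eq_intros simp: field_simps)
    qed (use a(1) in auto)
    finally show ?thesis using a(2) by simp
  qed
  have "(\<integral>\<^sup>+x. ?f x * indicator {x. r < k * x\<^sup>2} x \<partial>lborel)
      = (\<integral>\<^sup>+x. ?f x * indicator {a<..} x + ?f (- x) * indicator {a<..} (- x) \<partial>lborel)"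
    using a(1) by (intro nn_integral_cong) (auto simp: iff indicator_def abs_if)
  also have "\<dots> = (\<integral>\<^sup>+x. ?f x * indicator {a<..} x \<partial>lborel) + (\<integral>\<^sup>+x. ?f (- x) * indicator {a<..} (- x) \<partial>lborel)"
    by (rule nn_integral_add) measurable
  also have "(\<integral>\<^sup>+x. ?f (- x) * indicator {a<..} (- x) \<partial>lborel) = (\<integral>\<^sup>+x. ?f x * indicator {a<..} x \<partial>lborel)"
    by (subst (2) nn_integral_real_affine[where c="-1" and t=0]) auto
  finally have "(\<integral>\<^sup>+x. ?f x * indicator {x. r < k * x\<^sup>2} x \<partial>lborel) = ennreal (exp (- r) / (2 * k)) + ennreal (exp (- r) / (2 * k))"
    by (simp only: half)
  also have "\<dots> = ennreal (exp (- r)) * ennreal (1 / k)"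
    using k by (simp add: ennreal_plus[symmetric] ennreal_mult'[symmetric] del: ennreal_plus)
  finally show ?thesis .
qed

text \<open>Polar coordinates without the angle: substitute \<open>y = s x\<close> and integrate over \<open>x\<close> first. The
  remaining integral over \<open>s\<close> does not depend on \<open>r\<close>.\<close>

lemma nn_integral_heat_square_scale:
  fixes r :: real
  assumes r: "r \<ge> 0"
  shows "(\<integral>\<^sup>+x. \<integral>\<^sup>+y. ennreal (heat (1/2) x) * ennreal (heat (1/2) y) * indicator {q. r < q} (x\<^sup>2 + y\<^sup>2) \<partial>lborel \<partial>lborel)
    = ennreal (exp (- r)) * (\<integral>\<^sup>+s. ennreal (1 / pi) * ennreal (1 / (1 + s\<^sup>2)) \<partial>lborel)"
proof -
  have heat2: "ennreal (heat (1/2) x) * ennreal (heat (1/2) y) = ennreal (1 / pi) * ennreal (exp (- (x\<^sup>2 + y\<^sup>2)))" for x y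
    by (simp add: heat_eq ennreal_mult'[symmetric] exp_add[symmetric] add.commute)
  define g where "g x s = ennreal (1 / pi) * (ennreal (\<bar>x\<bar> * exp (- ((1 + s\<^sup>2) * x\<^sup>2))) * indicator {x. r < (1 + s\<^sup>2) * x\<^sup>2} x)" for x s :: real
  have [measurable]: "case_prod g \<in> borel_measurable (borel \<Otimes>\<^sub>M borel)"
    unfolding g_def by measurable
  have "(\<integral>\<^sup>+x. \<integral>\<^sup>+y. ennreal (heat (1/2) x) * ennreal (heat (1/2) y) * indicator {q. r < q} (x\<^sup>2 + y\<^sup>2) \<partial>lborel \<partial>lborel)
    = (\<integral>\<^sup>+x. \<integral>\<^sup>+s. g x s \<partial>lborel \<partial>lborel)"
  \<comment> \<open>The substitution \<open>y = x * s\<close> degenerates at \<open>x = 0\<close>, a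
    null set.\<close>
  proof (rule nn_integral_cong_AE, rule eventually_mono[OF AE_lborel_singleton[of 0]])
    fix x :: real assume x: "x \<noteq> 0"
    have sq: "x\<^sup>2 + (x * s)\<^sup>2 = (1 + s\<^sup>2) * x\<^sup>2" for s
      by (simp add: power2_eq_square algebra_simps)
    have "(\<integral>\<^sup>+y. ennreal (heat (1/2) x) * ennreal (heat (1/2) y) * indicator {q. r < q} (x\<^sup>2 + y\<^sup>2) \<partial>lborel)
      = ennreal \<bar>x\<bar> * (\<integral>\<^sup>+s. ennreal (1 / pi) * ennreal (exp (- ((1 + s\<^sup>2) * x\<^sup>2))) * indicator {q. r < q} ((1 + s\<^sup>2) * x\<^sup>2) \<partial>lborel)"
      unfolding heat2 using x by (subst nn_integral_real_affine[where c=x and t=0]) (simp_all add: sq)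
    also have "\<dots> = (\<integral>\<^sup>+s. ennreal \<bar>x\<bar> * (ennreal (1 / pi) * ennreal (exp (- ((1 + s\<^sup>2) * x\<^sup>2))) * indicator {q. r < q} ((1 + s\<^sup>2) * x\<^sup>2)) \<partial>lborel)"
      by (rule nn_integral_cmult[symmetric]) measurable
    also have "\<dots> = (\<integral>\<^sup>+s. g x s \<partial>lborel)"
      unfolding g_def by (intro nn_integral_cong) (simp add: ennreal_mult indicator_def mult_ac)
    finally show "(\<integral>\<^sup>+y. ennreal (heat (1/2) x) * ennreal (heat (1/2) y) * indicator {q. r < q} (x\<^sup>2 + y\<^sup>2) \<partial>lborel)
      = (\<integral>\<^sup>+s. g x s \<partial>lborel)" .
  qed
  also have "\<dots> = (\<integral>\<^sup>+s. \<integral>\<^sup>+x. g x s \<partial>lborel \<partial>lborel)"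
    by (rule lborel_pair.Fubini'[symmetric]) measurable
  also have "\<dots> = (\<integral>\<^sup>+s. ennreal (exp (- r)) * (ennreal (1 / pi) * ennreal (1 / (1 + s\<^sup>2))) \<partial>lborel)"
  proof (rule nn_integral_cong)
    fix s :: real
    have "(\<integral>\<^sup>+x. g x s \<partial>lborel) = ennreal (1 / pi) * (\<integral>\<^sup>+x. ennreal (\<bar>x\<bar> * exp (- ((1 + s\<^sup>2) * x\<^sup>2))) * indicator {x. r < (1 + s\<^sup>2) * x\<^sup>2} x \<partial>lborel)"
      unfolding g_def by (rule nn_integral_cmult) measurable
    also have "\<dots> = ennreal (1 / pi) * (ennreal (exp (- r)) * ennreal (1 / (1 + s\<^sup>2)))"
      using r by (subst nn_integral_radial) (auto simp: add_pos_nonneg)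
    finally show "(\<integral>\<^sup>+x. g x s \<partial>lborel) = ennreal (exp (- r)) * (ennreal (1 / pi) * ennreal (1 / (1 + s\<^sup>2)))"
      by (simp only: mult_ac)
  qed
  also have "\<dots> = ennreal (exp (- r)) * (\<integral>\<^sup>+s. ennreal (1 / pi) * ennreal (1 / (1 + s\<^sup>2)) \<partial>lborel)"
    by (rule nn_integral_cmult) measurable
  finally show ?thesis .
qed


lemma nn_integral_independent_heat:
  fixes Y Z :: "'a \<Rightarrow> real"
  assumes N: "prob_space N"
    and Y: "distributed N lborel Y (heat v)" and Z: "distributed N lborel Z (heat w)"
    and indep: "prob_space.indep_var N borel Y borel Z"
    and [measurable]: "case_prod f \<in> borel_measurable (borel \<Otimes>\<^sub>M borel)"
  shows "(\<integral>\<^sup>+\<omega>. f (Y \<omega>) (Z \<omega>) \<partial>N)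
    = (\<integral>\<^sup>+x. \<integral>\<^sup>+y. ennreal (heat v x) * ennreal (heat w y) * f x y \<partial>lborel \<partial>lborel)"
proof -
  interpret prob_space N by fact
  have "indep_var lborel (id \<circ> Y) lborel (id \<circ> Z)"
    by (rule indep_var_compose[OF indep]) auto
  then have "indep_var lborel Y lborel Z"
    by simp
  then have "distributed N (lborel \<Otimes>\<^sub>M lborel) (\<lambda>\<omega>. (Y \<omega>, Z \<omega>)) (\<lambda>(x, y). ennreal (heat v x) * ennreal (heat w y))"
    by (rule distributed_joint_indep[OF sigma_finite_lborel sigma_finite_lborel Y Z])
  from distributed_nn_integral[OF this, of "case_prod f"]
  have "(\<integral>\<^sup>+\<omega>. f (Y \<omega>) (Z \<omega>) \<partial>N)
      = (\<integral>\<^sup>+z. (case z of (x, y) \<Rightarrow> ennreal (heat v x) * ennreal (heat w y)) * case_prod f z \<partial>(lborel \<Otimes>\<^sub>M lborel))"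
    by simp
  also have "\<dots> = (\<integral>\<^sup>+x. \<integral>\<^sup>+y. ennreal (heat v x) * ennreal (heat w y) * f x y \<partial>lborel \<partial>lborel)"
    by (subst lborel.nn_integral_fst[symmetric]) (simp_all add: split_beta)
  finally show ?thesis .
qed

text \<open>The tail is \<open>exp (- q)\<close> times a constant \<open>C\<close> independent of
  \<open>q\<close>, so the arctangent integral behind \<open>C\<close> need not be evaluated:
  normalisation at \<open>q = 0\<close> determines it.\<close>

lemma prob_sum_squares_le:
  fixes Y Z :: "'a \<Rightarrow> real"
  assumes N: "prob_space N"
    and Y: "distributed N lborel Y (heat (1/2))" and Z: "distributed N lborel Z (heat (1/2))"
    and indep: "prob_space.indep_var N borel Y borel Z" and r: "r \<ge> 0"
  shows "measure N {\<omega> \<in> space N. (Y \<omega>)\<^sup>2 + (Z \<omega>)\<^sup>2 \<le> r} = 1 - exp (- r)"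
proof -
  interpret prob_space N by fact
  have [measurable]: "Y \<in> borel_measurable N" "Z \<in> borel_measurable N"
    using distributed_measurable[OF Y] distributed_measurable[OF Z] by simp_all
  define C where "C = (\<integral>\<^sup>+s. ennreal (1 / pi) * ennreal (1 / (1 + s\<^sup>2)) \<partial>lborel)"
  have gt: "emeasure N {\<omega> \<in> space N. q < (Y \<omega>)\<^sup>2 + (Z \<omega>)\<^sup>2} = ennreal (exp (- q)) * C" if "q \<ge> 0" for q
  proof -
    have "emeasure N {\<omega> \<in> space N. q < (Y \<omega>)\<^sup>2 + (Z \<omega>)\<^sup>2}
        = (\<integral>\<^sup>+\<omega>. indicator {\<omega> \<in> space N. q < (Y \<omega>)\<^sup>2 + (Z \<omega>)\<^sup>2} \<omega> \<partial>N)"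
      by (rule nn_integral_indicator[symmetric]) measurable
    also have "\<dots> = (\<integral>\<^sup>+\<omega>. indicator {u. q < u} ((Y \<omega>)\<^sup>2 + (Z \<omega>)\<^sup>2) \<partial>N)"
      by (intro nn_integral_cong) (simp add: indicator_def)
    also have "\<dots> = ennreal (exp (- q)) * C"
      unfolding C_def nn_integral_heat_square_scale[OF that, symmetric]
      by (rule nn_integral_independent_heat[OF N Y Z indep]) measurable
    finally show ?thesis .
  qed
  \<comment> \<open>\<open>Y\<close> has a density and so is almost surely nonzero; the tail at 0 is
    therefore 1, which forces \<open>C = 1\<close>.\<close>
  have "AE x in distr N lborel Y. x \<noteq> 0"
    unfolding distributed_distr_eq_density[OF Y]
    by (subst AE_density) (auto intro: eventually_mono[OF AE_lborel_singleton[of 0]])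
  then have "AE \<omega> in N. Y \<omega> \<noteq> 0"
    by (rule AE_distrD[rotated]) simp
  then have "AE \<omega> in N. \<omega> \<in> {\<omega> \<in> space N. 0 < (Y \<omega>)\<^sup>2 + (Z \<omega>)\<^sup>2}"
    using AE_space by eventually_elim (simp add: add_pos_nonneg)
  then have "emeasure N {\<omega> \<in> space N. 0 < (Y \<omega>)\<^sup>2 + (Z \<omega>)\<^sup>2} = 1"
    by (rule emeasure_eq_1_AE[rotated]) measurable
  with gt[of 0] have "C = 1" by simp
  have "prob {\<omega> \<in> space N. r < (Y \<omega>)\<^sup>2 + (Z \<omega>)\<^sup>2} = exp (- r)"
    using gt[OF r] \<open>C = 1\<close> by (simp add: emeasure_eq_measure)
  moreover have "prob {\<omega> \<in> space N. \<not> (Y \<omega>)\<^sup>2 + (Z \<omega>)\<^sup>2 \<le> r} = 1 - prob {\<omega> \<in> space N. (Y \<omega>)\<^sup>2 + (Z \<omega>)\<^sup>2 \<le> r}"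
    by (rule prob_neg) measurable
  ultimately show ?thesis
    by (simp add: not_le)
qed

lemma prob_largest_eigenvalue_M_bb_le:
  fixes Y Z :: "'a \<Rightarrow> real"
  assumes N: "prob_space N"
    and Y: "distributed N lborel Y (heat (1/2))" and Z: "distributed N lborel Z (heat (1/2))"
    and indep: "prob_space.indep_var N borel Y borel Z"
  shows "measure N {\<omega> \<in> space N. largest_eigenvalue (M_bb b1 b2 (Y \<omega>) (Z \<omega>)) \<le> x} = surv 2 (x - b2) (x - b1)"
proof (cases "b1 \<le> x \<and> b2 \<le> x")
  \<comment> \<open>The case includes \<open>x = b1\<close> and \<open>x = b2\<close>, where
    \<open>surv\<close> is 0 by definition and the exponential formula gives
    \<open>1 - exp 0\<close>, the same value.\<close>
  case True
  then have "0 \<le> (x - b2) * (x - b1)"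
    by simp
  from prob_sum_squares_le[OF N Y Z indep this] True show ?thesis
    by (auto simp: largest_eigenvalue_M_bb_le_iff surv_def)
next
  case False
  then show ?thesis
    by (auto simp: largest_eigenvalue_M_bb_le_iff surv_def)
qed

theorem theorem5p2:
  fixes b1 b2 :: real
    and M :: "'a measure" and X1 X2 :: "real \<Rightarrow> 'a \<Rightarrow> real"
    and N :: "'b measure" and Y1 Z1 :: "'b \<Rightarrow> real"
  assumes "standard_brownian_bridge M b1 X1"
    and "standard_brownian_bridge M b2 X2"
    and "prob_space.indep_var M path_space01 (path01 X1) path_space01 (path01 X2)"
    and "prob_space N"
    and "distributed N lborel Y1 (normal_density 0 (sqrt (1 / 2)))"
    and "distributed N lborel Z1 (normal_density 0 (sqrt (1 / 2)))"
    and "prob_space.indep_var N borel Y1 borel Z1"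
  shows "equal_in_law borel
           N (\<lambda>\<omega>. largest_eigenvalue (M_bb b1 b2 (Y1 \<omega>) (Z1 \<omega>)))
           M (V_bb X1 X2)"
proof -
  interpret M: prob_space M
    using assms(1) by (simp add: standard_brownian_bridge_def)
  interpret M: bridge_pair M b1 b2 X1 X2
    by unfold_locales (fact assms)+
  interpret N: prob_space N by fact
  have Y: "distributed N lborel Y1 (heat (1/2))" and Z: "distributed N lborel Z1 (heat (1/2))"
    using assms(5,6) by (simp_all add: heat_def)
  let ?L = "\<lambda>\<omega>. largest_eigenvalue (M_bb b1 b2 (Y1 \<omega>) (Z1 \<omega>))"
  have [measurable]: "Y1 \<in> borel_measurable N" "Z1 \<in> borel_measurable N"
    using distributed_measurable[OF Y] distributed_measurable[OF Z] by simp_all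
  have L [measurable]: "?L \<in> borel_measurable N"
    unfolding largest_eigenvalue_M_bb by measurable
  have "cdf (distr N borel ?L) = cdf (distr M borel (V_bb X1 X2))"
  proof
    fix x
    have "cdf (distr N borel ?L) x = measure N {\<omega> \<in> space N. ?L \<omega> \<le> x}"
      by (simp add: cdf_def measure_distr vimage_def Int_def conj_commute)
    also have "\<dots> = measure M {\<omega> \<in> space M. V_bb X1 X2 \<omega> \<le> x}"
      unfolding M.prob_V_le by (rule prob_largest_eigenvalue_M_bb_le[OF assms(4) Y Z assms(7)])
    also have "\<dots> = cdf (distr M borel (V_bb X1 X2)) x"
      by (simp add: cdf_def measure_distr vimage_def Int_def conj_commute)
    finally show "cdf (distr N borel ?L) x = cdf (distr M borel (V_bb X1 X2)) x" .
  qed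
  then have "distr N borel ?L = distr M borel (V_bb X1 X2)"
    by (intro cdf_unique N.real_distribution_distr M.real_distribution_distr) measurable
  with L M.measurable_V show ?thesis
    by (simp add: equal_in_law_def)
qed

end
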